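(* Let $\omega$ be irrational and let $A:\mathbb{T}\to \mathrm{SL}(2,\mathbb{R})$ be continuous such that the induced quasiperiodically forced circle homeomorphism $f_A:\mathbb{T}^2\to\mathbb{T}^2$ is homotopic to the identity. Suppose that the Lyapunov exponent $\lambda(\omega,A)$ is positive and that the fiberwise rotation number $\rho$ of $f_A$ and $\omega$ are rationally independent (i.e. $1,\omega,\rho$ are linearly independent over $\mathbb{Q}$). Then $f_A$ is $\rho$-unbounded and has sensitive dependence on initial conditions on $\mathbb{T}^2$. Moreover, the restriction of $f_A$ to the essential closure of each of its two invariant graphs has sensitive dependence on initial conditions.
   Context: $\mathbb{T}=\mathbb{R}/\mathbb{Z}$ is the circle. The cocycle $(\omega,A)$ is the map $\mathbb{T}\times\mathbb{R}^2\to\mathbb{T}\times\mathbb{R}^2$, $(\theta,v)\mapsto(\theta+\omega,A(\theta)v)$. Its projective action on $\mathbb{T}\times\mathbb{P}(\mathbb{R}^2)$, after identifying the real projective line $\mathbb{P}(\mathbb{R}^2)$ with $\mathbb{T}$ (a direction $(u,v)$ corresponds to $\frac1\pi\cot^{-1}(u/v)$), is a map $f_A(\theta,\xi)=(\theta+\omega,f_{A,\theta}(\xi))$ on $\mathbb{T}^2$ whose fiber maps are circle homeomorphisms. The Lyapunov exponent is $\lambda(\omega,A):=\liminf_{n\to\infty}\frac1n\int_{\mathbb{T}}\log\|A(\theta+(n-1)\omega)\cdots A(\theta)\|\,d\theta$. If $f=f_A$ is homotopic to the identity, let $F:\mathbb{T}\times\mathbb{R}\to\mathbb{T}\times\mathbb{R}$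 be a continuous lift and $F^n_\theta(\xi)$ the second coordinate of $F^n(\theta,\xi)$; the limit $\rho_F:=\lim_n\frac1n(F^n_\theta(\xi)-\xi)$ exists and is independent of $(\theta,\xi)$ (Herman), and the fiberwise rotation number is $\rho=\rho_F \bmod 1$. $f$ is $\rho$-bounded if $|F^n_\theta(\xi)-\xi-n\rho_F|$ is bounded uniformly in $\theta,\xi,n$, and $\rho$-unbounded otherwise. An invariant graph is a measurable $\varphi:\mathbb{T}\to\mathbb{T}$ with $f_{A,\theta}(\varphi(\theta))=\varphi(\theta+\omega)$ (graphs equal Lebesgue-a.e. are identified); when $\lambda(\omega,A)>0$ there are exactly two, corresponding to the stable and unstable Oseledets directions. The essential closure of $\varphi$ is the topological support of the measure $\mu_\varphi(B)=\mathrm{Leb}\{\theta:(\theta,\varphi(\theta))\in B\}$. A map $g:Y\to Y$ of a metric space $(Y,d)$ has sensitive dependence on initial conditions if there is $\varepsilon>0$ such that for all $\delta>0$ and $x\in Y$ there exist $n\ge 0$ and $y\in Y$ with $d(x,y)<\delta$ and $d(g^n(x),g^n(y))>\varepsilon$. *)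

theory Defs
  imports "HOL-Analysis.Analysis"
begin

section \<open>The circle \<open>\<real>/\<int>\<close>\<close>

quotient_type circle = real / "\<lambda>x y :: real. x - y \<in> \<int>"
proof (rule equivpI)
  show "reflp (\<lambda>x y :: real. x - y \<in> \<int>)"
    by (simp add: reflp_def)
  show "symp (\<lambda>x y :: real. x - y \<in> \<int>)"
    unfolding symp_def by (metis Ints_minus minus_diff_eq)
  show "transp (\<lambda>x y :: real. x - y \<in> \<int>)"
    unfolding transp_def by (metis Ints_add diff_add_cancel add_diff_eq)
qed

lift_definition circle_of :: "real \<Rightarrow> circle" is "\<lambda>x. x" .

lemma circle_of_eq_iff: "circle_of x = circle_of y \<longleftrightarrow> x - y \<in> \<int>"
  by transfer simp

lemma circle_of_surj: "\<exists>x. circle_of x = c"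
  by transfer (metis Ints_0 diff_self)

instantiation circle :: ab_group_add
begin

lift_definition zero_circle :: circle is "0 :: real" .
lift_definition plus_circle :: "circle \<Rightarrow> circle \<Rightarrow> circle" is "(+)"
  by (metis Ints_add add_diff_add)
lift_definition uminus_circle :: "circle \<Rightarrow> circle" is "uminus"
  by (metis Ints_minus minus_diff_minus)
lift_definition minus_circle :: "circle \<Rightarrow> circle \<Rightarrow> circle" is "(-)"
  by (metis (no_types) Ints_diff diff_diff_eq2 add_diff_eq diff_add_eq diff_diff_add add.commute)

instance
  by standard (transfer; simp)+

end

lemma circle_of_add: "circle_of (x + y) = circle_of x + circle_of y"
  by transfer simp

lemma circle_of_0: "circle_of 0 = 0"
  by transfer simp

lemma infdist_Ints_attained: "\<exists>n\<in>\<int>. infdist x \<int> = \<bar>x - n\<bar>" for x :: real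
  using infdist_attains_inf[of "\<int> :: real set" x] closed_Ints
  by (metis Ints_0 dist_real_def empty_iff)

lemma infdist_Ints_le: "n \<in> \<int> \<Longrightarrow> infdist x \<int> \<le> \<bar>x - n\<bar>" for x :: real
  by (metis dist_real_def infdist_le)

lemma infdist_Ints_cong:
  fixes x y :: real
  assumes "x - y \<in> \<int>"
  shows "infdist x \<int> = infdist y \<int>"
proof -
  have *: "infdist a \<int> \<le> infdist b \<int>" if "a - b \<in> \<int>" for a b :: real
  proof -
    obtain n where n: "n \<in> \<int>" "infdist b \<int> = \<bar>b - n\<bar>"
      using infdist_Ints_attained by blast
    have "infdist a \<int> \<le> \<bar>a - (n + (a - b))\<bar>"
      by (rule infdist_Ints_le) (use n that in \<open>auto intro: Ints_add\<close>)
    with n show ?thesis by simp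
  qed
  have "y - x \<in> \<int>"
    using assms by (metis Ints_minus minus_diff_eq)
  with assms show ?thesis
    by (intro antisym *)
qed

instantiation circle :: metric_space
begin

lift_definition dist_circle :: "circle \<Rightarrow> circle \<Rightarrow> real" is "\<lambda>x y. infdist (x - y) \<int>"
proof (rule infdist_Ints_cong)
  fix a b c d :: real
  assume "a - b \<in> \<int>" "c - d \<in> \<int>"
  then have "(a - b) - (c - d) \<in> \<int>" by (rule Ints_diff)
  then show "a - c - (b - d) \<in> \<int>" by (simp add: algebra_simps)
qed

definition uniformity_circle :: "(circle \<times> circle) filter" where
  "uniformity_circle = (INF e\<in>{0<..}. principal {(x, y). dist x y < e})"

definition open_circle :: "circle set \<Rightarrow> bool" where
  "open_circle U \<longleftrightarrow> (\<forall>x\<in>U. \<forall>\<^sub>F (x', y) in uniformity. x' = x \<longrightarrow> y \<in> U)"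

instance
proof
  show "dist x y = 0 \<longleftrightarrow> x = y" for x y :: circle
  proof transfer
    fix x y :: real
    show "infdist (x - y) \<int> = 0 \<longleftrightarrow> x - y \<in> \<int>"
      using in_closed_iff_infdist_zero[OF closed_Ints, of "x - y"] Ints_0 by auto
  qed
  show "dist x y \<le> dist x z + dist y z" for x y z :: circle
  proof transfer
    fix x y z :: real
    obtain m n where "m \<in> \<int>" "infdist (x - z) \<int> = \<bar>x - z - m\<bar>"
      and "n \<in> \<int>" "infdist (y - z) \<int> = \<bar>y - z - n\<bar>"
      using infdist_Ints_attained by metis
    moreover from this have "infdist (x - y) \<int> \<le> \<bar>x - y - (m - n)\<bar>"
      by (intro infdist_Ints_le Ints_diff)
    ultimately show "infdist (x - y) \<int> \<le> infdist (x - z) \<int> + infdist (y - z) \<int>"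
      by linarith
  qed
qed (simp_all add: uniformity_circle_def open_circle_def)

end

lemma dist_circle_of_le: "dist (circle_of x) (circle_of y) \<le> dist x y"
  using infdist_Ints_le[of 0 "x - y"] by transfer (simp add: dist_real_def)

lemma continuous_on_circle_of [continuous_intros]: "continuous_on S circle_of"
  unfolding continuous_on_iff using dist_circle_of_le by (meson order_le_less_trans)

lemma compact_UNIV_circle: "compact (UNIV :: circle set)"
proof -
  have "circle_of ` {0..1} = UNIV"
  proof (intro antisym subset_UNIV subsetI)
    fix c :: circle
    obtain x where x: "circle_of x = c" using circle_of_surj by blast
    have "circle_of (frac x) = c"
      unfolding x[symmetric] circle_of_eq_iff frac_def by simp
    moreover have "frac x \<in> {0..1}"
      using frac_lt_1[of x] by simp
    ultimately show "c \<in> circle_of ` {0..1}" by blast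
  qed
  then show ?thesis
    by (metis compact_Icc compact_continuous_image continuous_on_circle_of)
qed

instance circle :: second_countable_topology
proof
  define B :: "circle set set" where "B = (\<lambda>(p, q). ball (circle_of p) q) ` (\<rat> \<times> \<rat>)"
  have "countable B"
    unfolding B_def by (intro countable_image countable_SIGMA countable_rat)
  moreover have "topological_basis B"
  proof (rule topological_basisI)
    show "open U" if "U \<in> B" for U
      using that by (auto simp: B_def)
    fix U :: "circle set" and c
    assume "open U" "c \<in> U"
    then obtain e where e: "e > 0" "ball c e \<subseteq> U"
      by (meson openE)
    obtain q where q: "q \<in> \<rat>" "0 < q" "q < e / 2"
      using Rats_dense_in_real[of 0 "e / 2"] e by auto
    obtain x where x: "circle_of x = c" using circle_of_surj by blast
    obtain p where p: "p \<in> \<rat>" "x < p" "p < x + q"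
      using Rats_dense_in_real[of x "x + q"] q by auto
    have d: "dist (circle_of p) c < q"
      using dist_circle_of_le[of p x] p x by (simp add: dist_real_def)
    have "ball (circle_of p) q \<subseteq> ball c e"
    proof
      fix y
      assume "y \<in> ball (circle_of p) q"
      then have "dist (circle_of p) y < q" by simp
      with d q dist_triangle3[of c y "circle_of p"] show "y \<in> ball c e"
        by simp
    qed
    with d e p q show "\<exists>V\<in>B. c \<in> V \<and> V \<subseteq> U"
      by (intro bexI[of _ "ball (circle_of p) q"]) (auto simp: B_def)
  qed
  ultimately show "\<exists>B :: circle set set. countable B \<and> open = generate_topology B"
    using topological_basis_imp_subbasis by blast
qed

text \<open>Lebesgue measure on the circle (total mass \<open>1\<close>), on the \<open>\<sigma>\<close>-algebra of Lebesgue measurable sets.\<close>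

definition circle_lebesgue :: "circle measure" where
  "circle_lebesgue = completion (distr (restrict_space lborel {0..<1}) borel circle_of)"

section \<open>The projective line and the projective action\<close>

definition projective_line :: "(real^2) set set" where
  "projective_line = {L. subspace L \<and> dim L = 1}"

text \<open>
  The value of \<open>(1 / \<pi>) cot\<inverse> (u / v)\<close> in \<open>\<real>/\<int>\<close>, where \<open>cot\<inverse> x = \<pi> / 2 - arctan x\<close> is the branch
  with values in \<open>{0<..<\<pi>}\<close>; the direction with \<open>v = 0\<close> corresponds to \<open>cot\<inverse> \<infinity> = 0\<close>.
\<close>

definition direction_coord :: "real^2 \<Rightarrow> circle" where
  "direction_coord w =
     (if w $ 2 = 0 then 0 else circle_of ((pi / 2 - arctan (w $ 1 / w $ 2)) / pi))"

definition projective_coord :: "(real^2) set \<Rightarrow> circle" where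
  "projective_coord L = direction_coord (SOME w. w \<in> L \<and> w \<noteq> 0)"

lemma direction_coord_scale: "c \<noteq> 0 \<Longrightarrow> direction_coord (c *\<^sub>R w) = direction_coord w"
  by (simp add: direction_coord_def)

lemma projective_coord_span:
  assumes "w \<noteq> 0"
  shows "projective_coord (span {w}) = direction_coord w"
proof -
  define z where "z = (SOME z. z \<in> span {w} \<and> z \<noteq> 0)"
  have "z \<in> span {w} \<and> z \<noteq> 0"
    unfolding z_def by (rule someI[of _ w]) (use assms in \<open>simp add: span_base\<close>)
  then obtain c where "z = c *\<^sub>R w" "c \<noteq> 0"
    by (auto simp: span_singleton)
  then show ?thesis
    by (simp add: projective_coord_def direction_coord_scale flip: z_def)
qed

lemma direction_coord_cos_sin: "direction_coord (vector [cos (pi * x), sin (pi * x)]) = circle_of x"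
proof -
  define y where "y = frac x"
  have y: "0 \<le> y" "y < 1" using frac_lt_1[of x] by (simp_all add: y_def)
  obtain n :: int where x: "x = y + of_int n"
    unfolding y_def frac_def by (metis diff_add_cancel)
  define s :: real where "s = cos (pi * of_int n)"
  have s0: "sin (pi * of_int n) = 0" by simp
  have s: "s \<noteq> 0"
    using sin_cos_squared_add[of "pi * of_int n"] s0 by (auto simp: s_def)
  have "vector [cos (pi * x), sin (pi * x)] = s *\<^sub>R (vector [cos (pi * y), sin (pi * y)] :: real^2)"
    by (simp add: vec_eq_iff forall_2 x distrib_left cos_add sin_add s_def mult.commute)
  then have "direction_coord (vector [cos (pi * x), sin (pi * x)])
      = direction_coord (vector [cos (pi * y), sin (pi * y)])"
    using s by (simp add: direction_coord_scale)
  also have "\<dots> = circle_of y"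
  proof (cases "y = 0")
    case True
    then show ?thesis by (simp add: direction_coord_def circle_of_0)
  next
    case False
    with y have "0 < pi * y" "pi * y < pi" by simp_all
    then have pos: "sin (pi * y) > 0" by (rule sin_gt_zero)
    have "arctan (cos (pi * y) / sin (pi * y)) = pi / 2 - pi * y"
    proof (rule arctan_unique)
      show "- (pi / 2) < pi / 2 - pi * y" "pi / 2 - pi * y < pi / 2"
        using \<open>0 < pi * y\<close> \<open>pi * y < pi\<close> by linarith+
      show "tan (pi / 2 - pi * y) = cos (pi * y) / sin (pi * y)"
        by (simp add: tan_def sin_diff cos_diff)
    qed
    with pos show ?thesis by (simp add: direction_coord_def)
  qed
  also have "\<dots> = circle_of x"
    by (simp add: circle_of_eq_iff x)
  finally show ?thesis .
qed

lemma polar_direction: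
  fixes w :: "real^2"
  obtains r x where "w = r *\<^sub>R vector [cos (pi * x), sin (pi * x)]"
proof -
  define z where "z = Complex (w $ 1) (w $ 2)"
  have "z = rcis (cmod z) (Arg z)" by (simp add: rcis_cmod_Arg)
  then have "Re z = cmod z * cos (Arg z)" "Im z = cmod z * sin (Arg z)"
    by (metis Re_rcis, metis Im_rcis)
  then have "w = cmod z *\<^sub>R vector [cos (pi * (Arg z / pi)), sin (pi * (Arg z / pi))]"
    by (simp add: vec_eq_iff forall_2 z_def)
  then show ?thesis by (rule that)
qed

text \<open>\<open>projective_coord\<close> is indeed an identification of the projective line with the circle.\<close>

lemma bij_betw_projective_coord: "bij_betw projective_coord projective_line UNIV"
proof -
  define u :: "real \<Rightarrow> real^2" where "u x = vector [cos (pi * x), sin (pi * x)]" for x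
  have u0: "u x \<noteq> 0" for x
    using sin_zero_abs_cos_one[of "pi * x"] by (auto simp: u_def vec_eq_iff forall_2)
  have coord: "projective_coord (span {u x}) = circle_of x" for x
    using projective_coord_span[OF u0] by (simp add: u_def direction_coord_cos_sin)
  have line: "\<exists>x. L = span {u x}" if "L \<in> projective_line" for L
  proof -
    from that have L: "subspace L" "dim L = 1" by (simp_all add: projective_line_def)
    then obtain w where w: "w \<in> L" "w \<noteq> 0"
      by (metis dim_eq_0 subsetI singletonI zero_neq_one)
    obtain r x where rx: "w = r *\<^sub>R u x"
      unfolding u_def by (rule polar_direction)
    with w have "r \<noteq> 0" by auto
    then have "u x = inverse r *\<^sub>R w" by (simp add: rx)
    with L w have "u x \<in> L" by (simp add: subspace_scale)
    with L u0 have "span {u x} = L"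
      by (intro subspace_dim_equal) (simp_all add: span_minimal)
    then show ?thesis by blast
  qed
  have "inj_on projective_coord projective_line"
  proof (rule inj_onI)
    fix L L'
    assume "L \<in> projective_line" "L' \<in> projective_line" "projective_coord L = projective_coord L'"
    then obtain x y where xy: "L = span {u x}" "L' = span {u y}" "x - y \<in> \<int>"
      using line by (metis coord circle_of_eq_iff)
    then obtain n :: int where "x = y + of_int n"
      by (metis Ints_cases diff_add_cancel add.commute)
    then have u: "u x = cos (pi * of_int n) *\<^sub>R u y"
      by (simp add: u_def vec_eq_iff forall_2 distrib_left cos_add sin_add mult.commute)
    then have "cos (pi * of_int n) \<noteq> 0" using u0[of x] by auto
    then have "span {u x} = span {u y}"
      unfolding u using span_image_scale[of "{u y}" "\<lambda>_. cos (pi * of_int n)"] by simp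
    with xy show "L = L'" by simp
  qed
  moreover have "projective_coord ` projective_line = UNIV"
  proof (intro antisym subset_UNIV subsetI)
    fix c
    obtain x where "circle_of x = c" using circle_of_surj by blast
    moreover have "span {u x} \<in> projective_line"
      using u0 by (simp add: projective_line_def)
    ultimately show "c \<in> projective_coord ` projective_line"
      using coord by (metis image_eqI)
  qed
  ultimately show ?thesis by (simp add: bij_betw_def)
qed

definition fiber_map :: "real^2^2 \<Rightarrow> circle \<Rightarrow> circle" where
  "fiber_map M \<xi> = projective_coord ((*v) M ` inv_into projective_line projective_coord \<xi>)"

lemma fiber_map_circle_of:
  assumes "det M = 1"
  shows "fiber_map M (circle_of x) = direction_coord (M *v vector [cos (pi * x), sin (pi * x)])"
proof -
  define u :: "real^2" where "u = vector [cos (pi * x), sin (pi * x)]"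
  have u0: "u \<noteq> 0"
    using sin_zero_abs_cos_one[of "pi * x"] by (auto simp: u_def vec_eq_iff forall_2)
  have "inv_into projective_line projective_coord (circle_of x) = span {u}"
  proof (rule inv_into_f_eq)
    show "inj_on projective_coord projective_line"
      using bij_betw_projective_coord by (rule bij_betw_imp_inj_on)
    show "span {u} \<in> projective_line"
      using u0 by (simp add: projective_line_def)
    show "projective_coord (span {u}) = circle_of x"
      using projective_coord_span[OF u0] by (simp add: u_def direction_coord_cos_sin)
  qed
  moreover have "(*v) M ` span {u} = span {M *v u}"
    using linear_span_image[OF matrix_vector_mul_linear, of M "{u}"] by simp
  moreover have "M *v u \<noteq> 0"
  proof
    assume "M *v u = 0"
    moreover have "invertible M" using assms by (simp add: invertible_det_nz)
    ultimately show False
      using u0 by (metis invertible_def matrix_vector_mul_assoc matrix_vector_mul_lid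
          matrix_vector_mult_0_right)
  qed
  ultimately show ?thesis
    by (simp add: fiber_map_def projective_coord_span u_def)
qed

definition projective_cocycle ::
    "real \<Rightarrow> (circle \<Rightarrow> real^2^2) \<Rightarrow> circle \<times> circle \<Rightarrow> circle \<times> circle" where
  "projective_cocycle \<omega> A = (\<lambda>(\<theta>, \<xi>). (\<theta> + circle_of \<omega>, fiber_map (A \<theta>) \<xi>))"

section \<open>Lyapunov exponent\<close>

primrec cocycle_product :: "real \<Rightarrow> (circle \<Rightarrow> real^2^2) \<Rightarrow> nat \<Rightarrow> circle \<Rightarrow> real^2^2" where
  "cocycle_product \<omega> A 0 \<theta> = mat 1"
| "cocycle_product \<omega> A (Suc n) \<theta> = A (\<theta> + circle_of (real n * \<omega>)) ** cocycle_product \<omega> A n \<theta>"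

definition lyapunov_exponent :: "real \<Rightarrow> (circle \<Rightarrow> real^2^2) \<Rightarrow> ereal" where
  "lyapunov_exponent \<omega> A =
     liminf (\<lambda>n. ereal (1 / real n *
       (LINT \<theta>|circle_lebesgue. ln (onorm ((*v) (cocycle_product \<omega> A n \<theta>))))))"

section \<open>Fiberwise rotation number\<close>

definition is_lift :: "(circle \<times> circle \<Rightarrow> circle \<times> circle) \<Rightarrow>
    (circle \<times> real \<Rightarrow> circle \<times> real) \<Rightarrow> bool" where
  "is_lift f F \<longleftrightarrow> continuous_on UNIV F \<and> map_prod id circle_of \<circ> F = f \<circ> map_prod id circle_of"

definition lift_rotation_number :: "(circle \<times> real \<Rightarrow> circle \<times> real) \<Rightarrow> real" where
  "lift_rotation_number F =
     (THE r. \<forall>\<theta> \<xi>. (\<lambda>n. 1 / real n * (snd ((F ^^ n) (\<theta>, \<xi>)) - \<xi>)) \<longlonglongrightarrow> r)"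

text \<open>Two lifts differ by an integer constant, so the choice of the lift is immaterial.\<close>

definition fiberwise_rotation_number :: "(circle \<times> circle \<Rightarrow> circle \<times> circle) \<Rightarrow> circle" where
  "fiberwise_rotation_number f = circle_of (lift_rotation_number (SOME F. is_lift f F))"

definition rho_bounded :: "(circle \<times> circle \<Rightarrow> circle \<times> circle) \<Rightarrow> bool" where
  "rho_bounded f \<longleftrightarrow> (\<exists>F. is_lift f F \<and>
     (\<exists>C. \<forall>\<theta> \<xi> n. \<bar>snd ((F ^^ n) (\<theta>, \<xi>)) - \<xi> - real n * lift_rotation_number F\<bar> \<le> C))"

section \<open>Invariant graphs\<close>

text \<open>
  Graphs are identified when they agree almost everywhere; accordingly invariance is required
  almost everywhere.
\<close>

definition invariant_graph ::
    "real \<Rightarrow> (circle \<Rightarrow> real^2^2) \<Rightarrow> (circle \<Rightarrow> circle) \<Rightarrow> bool" where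
  "invariant_graph \<omega> A \<phi> \<longleftrightarrow> \<phi> \<in> borel_measurable circle_lebesgue \<and>
     (AE \<theta> in circle_lebesgue. fiber_map (A \<theta>) (\<phi> \<theta>) = \<phi> (\<theta> + circle_of \<omega>))"

definition graph_measure :: "(circle \<Rightarrow> circle) \<Rightarrow> (circle \<times> circle) measure" where
  "graph_measure \<phi> = distr circle_lebesgue borel (\<lambda>\<theta>. (\<theta>, \<phi> \<theta>))"

definition measure_support :: "'a :: topological_space measure \<Rightarrow> 'a set" where
  "measure_support M = {x. \<forall>U. open U \<and> x \<in> U \<longrightarrow> emeasure M U > 0}"

definition essential_closure :: "(circle \<Rightarrow> circle) \<Rightarrow> (circle \<times> circle) set" where
  "essential_closure \<phi> = measure_support (graph_measure \<phi>)"

section \<open>Sensitive dependence on initial conditions\<close>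

text \<open>The restriction of \<open>g\<close> to \<open>Y\<close> is a self-map of \<open>Y\<close> with sensitive dependence.\<close>

definition sensitive_dependence_on :: "'a :: metric_space set \<Rightarrow> ('a \<Rightarrow> 'a) \<Rightarrow> bool" where
  "sensitive_dependence_on Y g \<longleftrightarrow> g \<in> Y \<rightarrow> Y \<and>
     (\<exists>\<epsilon>>0. \<forall>\<delta>>0. \<forall>x\<in>Y. \<exists>n. \<exists>y\<in>Y. dist x y < \<delta> \<and> dist ((g ^^ n) x) ((g ^^ n) y) > \<epsilon>)"

end

theory Submission
  imports Defs
begin

text \<open>
  Write the displacement of \<open>f\<^sub>A\<close> in the fibres as a real function \<open>w\<close>, so that orbits of a lift are
  Birkhoff sums \<open>S\<^sub>n\<close> of \<open>w\<close>. Suppose \<open>S\<^sub>n - n\<rho>\<close> is bounded. On a minimal set \<open>M\<close> the theorem of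
  Gottschalk and Hedlund gives a continuous \<open>h\<close> conjugating the fibre action on \<open>M\<close> to the rotation by
  \<open>\<rho>\<close>, and rational independence makes \<open>(\<theta>, \<xi>) \<mapsto> (\<theta>, h(\<theta>, \<xi>))\<close> map \<open>M\<close> onto the torus. But
  a matrix product of large norm, which exists because the Lyapunov exponent is positive, maps the
  complement of a small arc to a small arc, so that \<open>h\<close> would map each fibre of \<open>M\<close> into two small
  subsets of the circle. Hence \<open>f\<^sub>A\<close> is \<open>\<rho>\<close>-unbounded.

  Without sensitive dependence on \<open>Y\<close>, the sums \<open>S\<^sub>n\<close> agree up to a constant on the points of \<open>Y\<close> in some
  small ball. When these points project to a set of positive measure, its return times under the
  rotation are relatively dense; hence \<open>n \<mapsto> S\<^sub>n\<close> is additive up to a bounded error along one orbit,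
  and, by monotonicity in the fibres and minimality of the rotation, \<open>f\<^sub>A\<close> is \<open>\<rho>\<close>-bounded.
\<close>

section \<open>The topological group of the circle\<close>

lemma dist_circle_of: "dist (circle_of x) (circle_of y) = infdist (x - y) \<int>"
  by transfer simp

lemma circle_of_minus: "circle_of (x - y) = circle_of x - circle_of y"
  by transfer simp

lemma dist_circle_add_right [simp]: "dist (a + c) (b + c) = dist a b" for a b c :: circle
  by transfer (simp add: algebra_simps)

lemma dist_circle_add_left [simp]: "dist (c + a) (c + b) = dist a b" for a b c :: circle
  by (metis add.commute dist_circle_add_right)

lemma dist_circle_diff: "dist (a - b) 0 = dist a b" for a b :: circle
  using dist_circle_add_right[of "a - b" b 0] by simp

lemma dist_circle_uminus: "dist (- a) (- b) = dist a b" for a b :: circle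
  using dist_circle_add_right[of "- a" "a + b" "- b"] by (simp add: dist_commute add.commute)

text \<open>Translation invariance makes addition 1-Lipschitz in each argument and negation an
  isometry.\<close>

instance circle :: topological_ab_group_add
proof
  fix a b :: circle
  have "((\<lambda>x. dist (fst x) a + dist (snd x) b) \<longlongrightarrow> 0 + 0) (nhds a \<times>\<^sub>F nhds b)"
    by (intro tendsto_add tendsto_dist_iff[THEN iffD1, OF filterlim_fst] tendsto_dist_iff[THEN iffD1, OF filterlim_snd])
  then have "((\<lambda>x. dist (fst x + snd x) (a + b)) \<longlongrightarrow> 0) (nhds a \<times>\<^sub>F nhds b)"
  proof (rule Lim_null_comparison[rotated, OF back_subst[of "\<lambda>c. (_ \<longlongrightarrow> c) _"]])
    have "dist (fst x + snd x) (a + b) \<le> dist (fst x) a + dist (snd x) b" for x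
      using dist_triangle[of "fst x + snd x" "a + b" "a + snd x"] by simp
    then show "\<forall>\<^sub>F x in nhds a \<times>\<^sub>F nhds b. norm (dist (fst x + snd x) (a + b)) \<le> dist (fst x) a + dist (snd x) b"
      by simp
  qed simp
  then show "LIM x nhds a \<times>\<^sub>F nhds b. fst x + snd x :> nhds (a + b)"
    by (rule tendsto_dist_iff[THEN iffD2])
  have "((\<lambda>x. dist x a) \<longlongrightarrow> 0) (nhds a)"
    by (rule tendsto_dist_iff[THEN iffD1, OF filterlim_ident])
  then show "(uminus \<longlongrightarrow> - a) (nhds a)"
    by (subst tendsto_dist_iff) (simp add: dist_circle_uminus)
qed

text \<open>The infimum over the integers that defines the distance is attained, so some
  representative realises it.\<close>

lemma circle_lift_near: "\<exists>y. circle_of y = c \<and> \<bar>x - y\<bar> = dist (circle_of x) c"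
proof -
  obtain z where z: "circle_of z = c" using circle_of_surj by blast
  obtain n where n: "n \<in> \<int>" "infdist (x - z) \<int> = \<bar>x - z - n\<bar>"
    using infdist_Ints_attained by blast
  have "circle_of (z + n) = c"
    using n(1) z by (simp add: circle_of_eq_iff flip: z)
  moreover have "\<bar>x - (z + n)\<bar> = dist (circle_of x) c"
    using n(2) z by (simp add: dist_circle_of flip: z)
  ultimately show ?thesis by blast
qed

lemma dist_circle_of_small:
  assumes "\<bar>x - y\<bar> \<le> 1/2"
  shows "dist (circle_of x) (circle_of y) = \<bar>x - y\<bar>"
proof -
  obtain n where n: "n \<in> \<int>" "infdist (x - y) \<int> = \<bar>x - y - n\<bar>"
    using infdist_Ints_attained by blast
  have "\<bar>x - y\<bar> \<le> \<bar>x - y - n\<bar>"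
  proof (cases "n = 0")
    case False
    with n(1) have "\<bar>n\<bar> \<ge> 1" by (rule Ints_nonzero_abs_ge1)
    with assms show ?thesis by linarith
  qed simp
  with n dist_circle_of_le[of x y] show ?thesis
    by (simp add: dist_circle_of dist_real_def)
qed

lemma dist_circle_le_half: "dist a b \<le> 1/2" for a b :: circle
proof -
  obtain x where x: "circle_of x = a" using circle_of_surj by blast
  obtain y where y: "circle_of y = b" using circle_of_surj by blast
  have "infdist (x - y) \<int> \<le> \<bar>x - y - of_int (round (x - y))\<bar>"
    by (rule infdist_Ints_le) simp
  also have "\<dots> \<le> 1/2"
    using of_int_round_abs_le[of "x - y"] by (simp add: abs_minus_commute)
  finally show ?thesis using x y dist_circle_of by metis
qed

text \<open>A section with values in \<open>[-1/2, 1/2]\<close>; the choice is ambiguous only at the class of \<open>1/2\<close>.\<close>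

definition circle_rep :: "circle \<Rightarrow> real" where
  "circle_rep c = (SOME x. circle_of x = c \<and> \<bar>x\<bar> = dist c 0)"

lemma circle_rep: "circle_of (circle_rep c) = c" "\<bar>circle_rep c\<bar> = dist c 0"
proof -
  have "\<exists>x. circle_of x = c \<and> \<bar>x\<bar> = dist c 0"
    using circle_lift_near[of c 0] by (simp add: circle_of_0 dist_commute)
  then have "circle_of (circle_rep c) = c \<and> \<bar>circle_rep c\<bar> = dist c 0"
    unfolding circle_rep_def by (rule someI_ex)
  then show "circle_of (circle_rep c) = c" "\<bar>circle_rep c\<bar> = dist c 0" by auto
qed

text \<open>The radius 1/4 keeps two representatives within 1/2 of each other, where the projection
  is isometric.\<close>

lemma circle_rep_isometric:
  assumes "dist c 0 \<le> 1/4" "dist d 0 \<le> 1/4"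
  shows "\<bar>circle_rep c - circle_rep d\<bar> = dist c d"
proof -
  have "\<bar>circle_rep c - circle_rep d\<bar> \<le> 1/2"
    using assms circle_rep(2)[of c] circle_rep(2)[of d] by linarith
  from dist_circle_of_small[OF this] show ?thesis by (simp add: circle_rep)
qed

lemma continuous_on_circle_rep: "continuous_on (cball 0 (1/4)) circle_rep"
  unfolding continuous_on_iff
  by (auto simp: dist_commute dist_real_def circle_rep_isometric)

text \<open>Cut the homotopy into steps so short that consecutive values differ by less than 1/4.
  Each difference has a small continuous real representative, and these telescope to a lift of the
  time-0 map because the time-1 map is 0.\<close>

lemma nullhomotopic_circle_map_lifts:
  fixes u :: "real \<times> 'a::metric_space \<Rightarrow> circle"
  assumes cont: "continuous_on ({0..1} \<times> UNIV) u" and cpt: "compact (UNIV :: 'a set)"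
    and end0: "\<And>z. u (1, z) = 0"
  shows "\<exists>w. continuous_on UNIV w \<and> (\<forall>z. circle_of (w z) = u (0, z))"
proof -
  have "uniformly_continuous_on ({0..1} \<times> UNIV) u"
    by (intro compact_uniformly_continuous cont compact_Times cpt compact_Icc)
  then obtain d where d: "d > 0"
    "\<And>p q. p \<in> {0..1} \<times> UNIV \<Longrightarrow> q \<in> {0..1} \<times> UNIV \<Longrightarrow> dist q p < d \<Longrightarrow> dist (u q) (u p) < 1/4"
    unfolding uniformly_continuous_on_def by (metis zero_less_divide_1_iff zero_less_numeral)
  obtain N :: nat where N: "N > 0" "1 / real N < d"
    using d(1) by (metis gr0I inverse_eq_divide real_arch_inverse)
  define t where "t i = real i / real N" for i
  have t: "t i \<in> {0..1}" if "i \<le> N" for i using that N by (simp add: t_def)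
  define s where "s i z = u (t i, z) - u (t (Suc i), z)" for i z
  have small: "s i z \<in> cball 0 (1/4)" if "i < N" for i z
  proof -
    have "dist (t i, z) (t (Suc i), z) = 1 / real N"
      by (simp add: dist_Pair_Pair dist_real_def t_def diff_divide_distrib[symmetric])
    then have "dist (u (t i, z)) (u (t (Suc i), z)) < 1/4"
      using N t[of i] t[of "Suc i"] that by (intro d(2)) auto
    then show ?thesis
      using dist_circle_diff by (simp add: s_def dist_commute)
  qed
  define w where "w z = (\<Sum>i<N. circle_rep (s i z))" for z
  have "continuous_on UNIV w"
    unfolding w_def
  proof (intro continuous_on_sum)
    fix i assume i: "i \<in> {..<N}"
    have "continuous_on UNIV (\<lambda>z. u (t j, z))" if "j \<le> N" for j
      by (rule continuous_on_compose2[OF cont]) (use t[OF that] in \<open>auto intro!: continuous_intros\<close>)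
    with i have "continuous_on UNIV (s i)"
      unfolding s_def by (intro continuous_on_diff) auto
    then show "continuous_on UNIV (\<lambda>z. circle_rep (s i z))"
      by (rule continuous_on_compose2[OF continuous_on_circle_rep]) (use small i in auto)
  qed
  moreover have "circle_of (w z) = u (0, z)" for z
  proof -
    have "circle_of (\<Sum>i<n. circle_rep (s i z)) = u (t 0, z) - u (t n, z)" for n
      by (induction n) (simp_all add: circle_of_0 circle_of_add circle_rep s_def)
    then show ?thesis using N end0 by (simp add: w_def t_def)
  qed
  ultimately show ?thesis by blast
qed

section \<open>Kronecker's theorem on the torus\<close>

text \<open>Kronecker's theorem supplies an integer time \<open>k\<close>, possibly negative.
  Dirichlet's theorem supplies a positive \<open>q\<close> that is nearly a common period of both
  rotations and serves to repair the sign.\<close>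

lemma translation_orbit_dense:
  fixes \<omega> r :: real and \<alpha> \<beta> :: circle
  assumes indep: "\<And>a b c :: int. of_int a + of_int b * \<omega> + of_int c * r = 0 \<Longrightarrow> a = 0 \<and> b = 0 \<and> c = 0"
    and "e > 0"
  shows "\<exists>n::nat. dist (circle_of (real n * \<omega>)) \<alpha> < e \<and> dist (circle_of (real n * r)) \<beta> < e"
proof -
  obtain x where x: "circle_of x = \<alpha>" using circle_of_surj by blast
  obtain y where y: "circle_of y = \<beta>" using circle_of_surj by blast
  \<comment> \<open>Kronecker's theorem takes a list of reals ending in 1; its independence over the
    integers is that of 1, \<omega>, \<open>r\<close>.\<close>
  define \<tau> :: "nat \<Rightarrow> real" where "\<tau> = (\<lambda>i. if i = 0 then \<omega> else if i = 1 then r else 1)"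
  define a :: "nat \<Rightarrow> real" where "a = (\<lambda>i. if i = 0 then x else y)"
  have upto2: "{..2::nat} = {0, 1, 2}" by auto
  have inj: "inj_on \<tau> {..2}"
  proof -
    have "\<omega> \<noteq> r" using indep[of 0 1 "-1"] by auto
    moreover have "\<omega> \<noteq> 1" using indep[of 1 "-1" 0] by auto
    moreover have "r \<noteq> 1" using indep[of 1 0 "-1"] by auto
    ultimately show ?thesis unfolding upto2 by (auto simp: inj_on_def \<tau>_def)
  qed
  interpret Modules.module "(\<lambda>r. (*) (real_of_int r))"
    by (simp add: Modules.module.intro distrib_left mult.commute)
  have "independent (\<tau> ` {..2})"
  proof
    assume "dependent (\<tau> ` {..2})"
    then obtain u where u: "(\<Sum>v\<in>\<tau> ` {..2}. real_of_int (u v) * v) = 0"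
      "\<exists>v\<in>\<tau> ` {..2}. u v \<noteq> 0"
      by (subst (asm) dependent_finite) auto
    have "(\<Sum>v\<in>\<tau> ` {..2}. real_of_int (u v) * v) = (\<Sum>i\<in>{..2}. real_of_int (u (\<tau> i)) * \<tau> i)"
      using inj by (simp add: sum.reindex)
    also have "\<dots> = of_int (u 1) + of_int (u \<omega>) * \<omega> + of_int (u r) * r"
      unfolding upto2 by (simp add: \<tau>_def)
    finally have "u 1 = 0 \<and> u \<omega> = 0 \<and> u r = 0"
      using u(1) indep by simp
    with u(2) show False unfolding upto2 by (auto simp: \<tau>_def)
  qed
  then obtain k m where km: "\<And>i. i < 2 \<Longrightarrow> \<bar>of_int k * \<tau> i - of_int (m i) - a i\<bar> < e / 2"
    using Kronecker_thm_2[of \<tau> 2 "e / 2" a] inj \<open>e > 0\<close> by (auto simp: \<tau>_def)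
  \<comment> \<open>With this \<open>N\<close>, at most \<open>|k|\<close> approximation errors
    below 1 / \<open>N\<close> add up to at most \<open>e / 2\<close>.\<close>
  obtain N :: nat where N: "real N > 2 * \<bar>of_int k\<bar> / e" "N > 0"
    using reals_Archimedean2 by (metis gr0I less_trans of_nat_0 of_nat_less_0_iff zero_less_one of_nat_0_less_iff
      abs_ge_zero max_less_iff_conj)
  obtain q p where q: "0 < q" "\<And>i. i < 2 \<Longrightarrow> \<bar>of_int q * \<tau> i - of_int (p i)\<bar> < 1 / N"
    using Dirichlet_approx_simult[OF N(2), of 2 \<tau>] by metis
  text \<open>Adding a multiple of a good common period makes the time nonnegative.\<close>
  define n where "n = nat (k + \<bar>k\<bar> * q)"
  have "\<bar>k\<bar> * q \<ge> \<bar>k\<bar> * 1" using q(1) by (intro mult_left_mono) auto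
  then have n: "real n = of_int k + \<bar>of_int k\<bar> * of_int q"
    unfolding n_def by (subst of_nat_nat) auto
  have "dist (circle_of (real n * \<tau> i)) (circle_of (a i)) < e" if i: "i < 2" for i
  proof -
    have "infdist (real n * \<tau> i - a i) \<int> \<le> \<bar>real n * \<tau> i - a i - of_int (m i + \<bar>k\<bar> * p i)\<bar>"
      by (rule infdist_Ints_le) simp
    also have "\<dots> = \<bar>(of_int k * \<tau> i - of_int (m i) - a i) + \<bar>of_int k\<bar> * (of_int q * \<tau> i - of_int (p i))\<bar>"
      by (simp add: n algebra_simps)
    also have "\<dots> \<le> \<bar>of_int k * \<tau> i - of_int (m i) - a i\<bar> + \<bar>of_int k\<bar> * \<bar>of_int q * \<tau> i - of_int (p i)\<bar>"
      by (rule order_trans[OF abs_triangle_ineq]) (simp add: abs_mult)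
    also have "\<dots> \<le> \<bar>of_int k * \<tau> i - of_int (m i) - a i\<bar> + \<bar>of_int k\<bar> * (1 / N)"
      using q(2)[OF i] by (intro add_left_mono mult_left_mono) auto
    also have "\<bar>of_int k\<bar> * (1 / N) \<le> e / 2"
      using N \<open>e > 0\<close> by (simp add: field_simps)
    finally show ?thesis using km[OF i] by (simp add: dist_circle_of)
  qed
  from this[of 0] this[of 1] x y show ?thesis
    by (intro exI[of _ n]) (auto simp: \<tau>_def a_def)
qed

section \<open>Projective action of unimodular matrices\<close>

text \<open>The factor \<pi> makes \<open>x\<close> and \<open>x + 1\<close> give opposite vectors,
  hence the same line, in agreement with \<open>direction_coord\<close>.\<close>

definition unit_dir :: "real \<Rightarrow> real^2" where
  "unit_dir x = vector [cos (pi * x), sin (pi * x)]"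

text \<open>Oriented area: the determinant of the matrix with columns \<open>v\<close> and
  \<open>w\<close>.\<close>

definition cross2 :: "real^2 \<Rightarrow> real^2 \<Rightarrow> real" where
  "cross2 v w = v $ 1 * w $ 2 - v $ 2 * w $ 1"

lemma cross2_matrix: "cross2 (M *v v) (M *v w) = det M * cross2 v w"
  by (simp add: cross2_def matrix_vector_mult_def sum_2 det_2 algebra_simps)

lemma cross2_unit_dir: "cross2 (unit_dir x) (unit_dir y) = sin (pi * (y - x))"
  by (simp add: cross2_def unit_dir_def sin_diff algebra_simps)

lemma norm_unit_dir [simp]: "norm (unit_dir x) = 1"
  by (simp add: norm_vec_def L2_set_def sum_2 unit_dir_def)

lemma cross2_scaleR: "cross2 (a *\<^sub>R v) (b *\<^sub>R w) = a * b * cross2 v w"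
  by (simp add: cross2_def algebra_simps)

text \<open>Cramer's rule with the denominator cleared, so that parallel directions are no
  exception.\<close>

lemma unit_dir_decompose:
  "sin (pi * (y - x)) *\<^sub>R unit_dir z =
    sin (pi * (y - z)) *\<^sub>R unit_dir x + sin (pi * (z - x)) *\<^sub>R unit_dir y"
proof -
  have "cross2 v w *\<^sub>R u = cross2 u w *\<^sub>R v + cross2 v u *\<^sub>R w" for u v w
    by (simp add: cross2_def vec_eq_iff forall_2 algebra_simps)
  then show ?thesis by (metis cross2_unit_dir)
qed

text \<open>Polar coordinates of the image vector give \<open>c\<close> and \<open>y\<close>. This
  links the linear action to \<open>fiber_map\<close>: \<bar>\<open>c\<close>\<bar> is the expansion
  factor of the direction \<open>x\<close>.\<close>

lemma matrix_unit_dir: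
  fixes M :: "real^2^2"
  assumes "det M = 1"
  obtains c y where "M *v unit_dir x = c *\<^sub>R unit_dir y" "fiber_map M (circle_of x) = circle_of y" "c \<noteq> 0"
proof -
  obtain c y where c: "M *v unit_dir x = c *\<^sub>R unit_dir y"
    unfolding unit_dir_def[of y for y] using polar_direction unit_dir_def by metis
  have "invertible M" using assms by (simp add: invertible_det_nz)
  then have "M *v unit_dir x \<noteq> 0"
    using norm_unit_dir[of x]
    by (metis invertible_def matrix_vector_mul_assoc matrix_vector_mul_lid
          matrix_vector_mult_0_right norm_zero zero_neq_one)
  with c have "c \<noteq> 0" by auto
  moreover have "fiber_map M (circle_of x) = circle_of y"
    using fiber_map_circle_of[OF assms, of x] c \<open>c \<noteq> 0\<close> direction_coord_scale direction_coord_cos_sin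
    by (metis unit_dir_def)
  ultimately show ?thesis using c that by blast
qed

lemma fiber_map_mult:
  assumes "det M = 1" "det M' = 1"
  shows "fiber_map (M ** M') \<xi> = fiber_map M (fiber_map M' \<xi>)"
proof -
  obtain x where x: "circle_of x = \<xi>" using circle_of_surj by blast
  obtain c y where y: "M' *v unit_dir x = c *\<^sub>R unit_dir y" "fiber_map M' (circle_of x) = circle_of y" "c \<noteq> 0"
    using matrix_unit_dir[OF assms(2)] by metis
  obtain d z where z: "M *v unit_dir y = d *\<^sub>R unit_dir z" "fiber_map M (circle_of y) = circle_of z" "d \<noteq> 0"
    using matrix_unit_dir[OF assms(1)] by metis
  have "fiber_map (M ** M') (circle_of x) = direction_coord ((M ** M') *v unit_dir x)"
    unfolding unit_dir_def by (rule fiber_map_circle_of) (simp add: det_mul assms)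
  also have "(M ** M') *v unit_dir x = (c * d) *\<^sub>R unit_dir z"
    by (simp add: y z matrix_vector_mult_scaleR flip: matrix_vector_mul_assoc)
  also have "direction_coord \<dots> = circle_of z"
    using y z by (simp add: direction_coord_scale unit_dir_def direction_coord_cos_sin)
  finally show ?thesis using x y z by simp
qed

lemma fiber_map_id: "fiber_map (mat 1) \<xi> = \<xi>"
  using fiber_map_circle_of[of "mat 1"] circle_of_surj[of \<xi>] direction_coord_cos_sin
  by (auto simp: matrix_vector_mul_lid)

lemma inj_fiber_map:
  assumes "det M = 1"
  shows "inj (fiber_map M)"
proof (rule injI)
  fix \<xi> \<eta> assume eq: "fiber_map M \<xi> = fiber_map M \<eta>"
  have "invertible M" using assms by (simp add: invertible_det_nz)
  then obtain M' where M': "M' ** M = mat 1" unfolding invertible_def by blast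
  then have "det M' * det M = 1" by (metis det_I det_mul)
  with assms have "det M' = 1" by simp
  then have "fiber_map M' (fiber_map M \<zeta>) = \<zeta>" for \<zeta>
    using fiber_map_mult[of M' M] assms M' fiber_map_id by metis
  with eq show "\<xi> = \<eta>" by metis
qed

text \<open>It converts estimates of oriented areas of unit vectors into distances of directions. By
  periodicity only representatives in [-1/2, 1/2] matter.\<close>

lemma dist_circle_le_sin: "dist (circle_of x) (circle_of y) \<le> \<bar>sin (pi * (x - y))\<bar>"
proof -
  obtain n where n: "n \<in> \<int>" "infdist (x - y) \<int> = \<bar>x - y - n\<bar>"
    using infdist_Ints_attained by blast
  define d where "d = x - y - n"
  have d: "dist (circle_of x) (circle_of y) = \<bar>d\<bar>" "\<bar>d\<bar> \<le> 1/2"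
    using n dist_circle_le_half[of "circle_of x" "circle_of y"] by (simp_all add: dist_circle_of d_def)
  obtain k :: int where k: "n = of_int k" using n(1) Ints_cases by blast
  have "sin (pi * (x - y)) = sin (pi * d + pi * of_int k)" by (simp add: d_def k algebra_simps)
  also have "\<dots> = sin (pi * d) * cos (pi * of_int k)" by (simp add: sin_add)
  finally have s: "\<bar>sin (pi * (x - y))\<bar> = \<bar>sin (pi * d)\<bar>"
    using sin_zero_abs_cos_one[of "pi * of_int k"] by (simp add: abs_mult)
  have "\<bar>d\<bar> \<le> \<bar>sin (pi * d)\<bar>"
  proof -
    \<comment> \<open>Since 1.6 bounds \<pi>/2, the cubic Taylor estimate yields sin a \<ge> a/2,
      and \<pi> > 2 makes a/2 at least \<bar>d\<bar>.\<close>
    define a where "a = pi * \<bar>d\<bar>"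
    have a: "0 \<le> a" "a \<le> 1.6" using d(2) pi_approx mult_mono[of pi "3.2" "\<bar>d\<bar>" "1/2"] by (auto simp: a_def)
    have "\<bar>sin a - (\<Sum>m<3. sin_coeff m * a ^ m)\<bar> \<le> inverse (fact 3) * \<bar>a\<bar> ^ 3"
      by (rule Maclaurin_sin_bound)
    then have "\<bar>sin a - a\<bar> \<le> a ^ 3 / 6"
      using a by (simp add: eval_nat_numeral sin_coeff_def fact_numeral)
    then have "sin a \<ge> a - a ^ 3 / 6" by linarith
    moreover have "a ^ 3 / 6 \<le> a / 2"
    proof -
      have "a\<^sup>2 \<le> 1.6\<^sup>2" using a by (intro power_mono)
      then have "a * a\<^sup>2 \<le> a * 3" using a by (intro mult_left_mono) (auto simp: power2_eq_square)
      then show ?thesis by (simp add: power2_eq_square power3_eq_cube)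
    qed
    moreover have "a / 2 \<ge> \<bar>d\<bar>" using pi_gt3 mult_right_mono[of 2 pi "\<bar>d\<bar>"] by (simp add: a_def)
    ultimately have "\<bar>d\<bar> \<le> sin a" by linarith
    moreover have "\<bar>sin a\<bar> = \<bar>sin (pi * d)\<bar>" by (cases "d \<ge> 0") (simp_all add: a_def)
    ultimately show ?thesis by linarith
  qed
  with s d show ?thesis by simp
qed

text \<open>Directions are split by their expansion factor at the threshold \<open>sqrt N\<close>.
  Two weakly expanded directions are nearly parallel, as otherwise linearity would bound the factor
  of every direction, against one expanded by more than \<open>N\<close>. Two strongly expanded
  directions have nearly parallel images because the oriented area is preserved.\<close>

lemma fiber_map_contraction:
  fixes M :: "real^2^2"
  assumes det: "det M = 1" and N: "onorm ((*v) M) > N" "N \<ge> 1"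
  shows "\<exists>P. (\<forall>\<xi>\<in>P. \<forall>\<eta>\<in>P. dist \<xi> \<eta> \<le> 2 / sqrt N) \<and>
    (\<forall>\<xi>\<in>-P. \<forall>\<eta>\<in>-P. dist (fiber_map M \<xi>) (fiber_map M \<eta>) \<le> 2 / sqrt N)"
proof -
  let ?m = "\<lambda>x. norm (M *v unit_dir x)"
  define P where "P = circle_of ` {x. ?m x \<le> sqrt N}"
  have sN: "sqrt N > 0" "sqrt N * sqrt N = N" using N by auto
  obtain x0 where x0: "?m x0 > N"
  proof (rule ccontr)
    assume "\<not> thesis"
    then have le: "?m x \<le> N" for x using that not_le by blast
    have "norm (M *v v) \<le> N * norm v" for v
    proof -
      obtain r x where v: "v = r *\<^sub>R unit_dir x"
        unfolding unit_dir_def using polar_direction by metis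
      have "norm (M *v v) = \<bar>r\<bar> * ?m x" by (simp add: v matrix_vector_mult_scaleR)
      also have "\<dots> \<le> \<bar>r\<bar> * N" using le by (intro mult_left_mono) auto
      finally show ?thesis by (simp add: v mult.commute)
    qed
    then have "onorm ((*v) M) \<le> N" by (rule onorm_le)
    with N show False by simp
  qed
  have "dist \<xi> \<eta> \<le> 2 / sqrt N" if P: "\<xi> \<in> P" "\<eta> \<in> P" for \<xi> \<eta>
  proof -
    obtain x y where xy: "\<xi> = circle_of x" "\<eta> = circle_of y" "?m x \<le> sqrt N" "?m y \<le> sqrt N"
      using P unfolding P_def by blast
    let ?s = "sin (pi * (y - x))"
    have "\<bar>?s\<bar> * N \<le> \<bar>?s\<bar> * ?m x0" using x0 by (intro mult_left_mono) auto
    also have "\<dots> = norm (M *v (?s *\<^sub>R unit_dir x0))" by (simp add: matrix_vector_mult_scaleR)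
    also have "\<dots> = norm (sin (pi * (y - x0)) *\<^sub>R (M *v unit_dir x) + sin (pi * (x0 - x)) *\<^sub>R (M *v unit_dir y))"
      by (subst unit_dir_decompose) (simp add: matrix_vector_mult_scaleR matrix_vector_right_distrib)
    also have "\<dots> \<le> \<bar>sin (pi * (y - x0))\<bar> * ?m x + \<bar>sin (pi * (x0 - x))\<bar> * ?m y"
      by (rule order_trans[OF norm_triangle_ineq]) simp
    also have "\<dots> \<le> 1 * sqrt N + 1 * sqrt N"
      using xy sN by (intro add_mono mult_mono) auto
    finally have "\<bar>?s\<bar> * sqrt N * sqrt N \<le> 2 * sqrt N" using sN(2) by (simp add: mult.assoc)
    then have "\<bar>?s\<bar> \<le> 2 / sqrt N" using sN(1) by (simp add: field_simps)
    then show ?thesis using dist_circle_le_sin[of y x] xy by (simp add: dist_commute)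
  qed
  moreover have "dist (fiber_map M \<xi>) (fiber_map M \<eta>) \<le> 2 / sqrt N" if "\<xi> \<notin> P" "\<eta> \<notin> P" for \<xi> \<eta>
  proof -
    obtain x y where xy: "\<xi> = circle_of x" "\<eta> = circle_of y" using circle_of_surj by metis
    with that have big: "?m x \<ge> sqrt N" "?m y \<ge> sqrt N" by (auto simp: P_def)
    obtain c x' where x': "M *v unit_dir x = c *\<^sub>R unit_dir x'" "fiber_map M (circle_of x) = circle_of x'"
      using matrix_unit_dir[OF det] by metis
    obtain d y' where y': "M *v unit_dir y = d *\<^sub>R unit_dir y'" "fiber_map M (circle_of y) = circle_of y'"
      using matrix_unit_dir[OF det] by metis
    have cd: "\<bar>c\<bar> \<ge> sqrt N" "\<bar>d\<bar> \<ge> sqrt N" using big x' y' by simp_all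
    have "c * d * sin (pi * (y' - x')) = sin (pi * (y - x))"
      using cross2_matrix[of M "unit_dir x" "unit_dir y"] det x' y' by (simp add: cross2_scaleR cross2_unit_dir)
    then have "\<bar>c\<bar> * \<bar>d\<bar> * \<bar>sin (pi * (y' - x'))\<bar> \<le> 1"
      by (metis abs_mult abs_sin_le_one)
    moreover have "sqrt N * sqrt N * \<bar>sin (pi * (y' - x'))\<bar> \<le> \<bar>c\<bar> * \<bar>d\<bar> * \<bar>sin (pi * (y' - x'))\<bar>"
      using cd sN by (intro mult_mono) auto
    ultimately have "sqrt N * (sqrt N * \<bar>sin (pi * (y' - x'))\<bar>) \<le> 1"
      unfolding mult.assoc[symmetric] by linarith
    \<comment> \<open>The area argument even gives the bound 1 / \<open>N\<close>; as
      \<open>N\<close> \<ge> 1, it is weakened to the constant of the first half.\<close>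
    moreover have "1 * (sqrt N * \<bar>sin (pi * (y' - x'))\<bar>) \<le> sqrt N * (sqrt N * \<bar>sin (pi * (y' - x'))\<bar>)"
      using N sN by (intro mult_right_mono) auto
    ultimately have "sqrt N * \<bar>sin (pi * (y' - x'))\<bar> \<le> 2" by linarith
    then have "\<bar>sin (pi * (y' - x'))\<bar> \<le> 2 / sqrt N" using sN(1) by (simp add: field_simps)
    then show ?thesis using dist_circle_le_sin[of y' x'] x' y' xy by (simp add: dist_commute)
  qed
  ultimately show ?thesis by (intro exI[of _ P]) auto
qed

section \<open>Minimal sets and Birkhoff sums\<close>

text \<open>Zorn's lemma for closed invariant sets ordered by reverse inclusion, expressed through
  complements. Compactness keeps the intersection of a chain nonempty.\<close>

lemma compact_minimal_invariant_set:
  fixes f :: "'a::t2_space \<Rightarrow> 'a"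
  assumes cpt: "compact K" "K \<noteq> {}" and inv: "f ` K \<subseteq> K"
  obtains M where "M \<subseteq> K" "closed M" "M \<noteq> {}" "f ` M \<subseteq> M"
    "\<And>C. C \<subseteq> M \<Longrightarrow> closed C \<Longrightarrow> C \<noteq> {} \<Longrightarrow> f ` C \<subseteq> C \<Longrightarrow> C = M"
proof -
  define X where "X = {C. C \<subseteq> K \<and> closed C \<and> C \<noteq> {} \<and> f ` C \<subseteq> C}"
  have KX: "K \<in> X" using assms compact_imp_closed by (auto simp: X_def)
  have "\<exists>M\<in>uminus ` X. \<forall>Y\<in>uminus ` X. M \<subseteq> Y \<longrightarrow> Y = M"
  proof (rule subset_Zorn_nonempty)
    show "uminus ` X \<noteq> {}" using KX by blast
    fix \<C> assume ne: "\<C> \<noteq> {}" and ch: "subset.chain (uminus ` X) \<C>"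
    define \<D> where "\<D> = uminus ` \<C>"
    have \<D>: "\<D> \<subseteq> X" "\<D> \<noteq> {}" using ne ch by (auto simp: \<D>_def subset.chain_def)
    have \<D>ch: "A \<subseteq> B \<or> B \<subseteq> A" if AB: "A \<in> \<D>" "B \<in> \<D>" for A B
    proof -
      obtain A' B' where "A = - A'" "B = - B'" "A' \<in> \<C>" "B' \<in> \<C>"
        using AB by (auto simp: \<D>_def)
      then show ?thesis using ch by (auto simp: subset_chain_def)
    qed
    \<comment> \<open>A finite nonempty subfamily of a chain has a least member, which is its
      intersection.\<close>
    have fin: "\<Inter>F \<in> \<D>" if "finite F" "F \<noteq> {}" "F \<subseteq> \<D>" for F
      using that
    proof (induction F rule: finite_ne_induct)
      case (insert A F)
      then have "A \<in> \<D>" "\<Inter>F \<in> \<D>" by auto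
      then have "A \<inter> \<Inter>F = A \<or> A \<inter> \<Inter>F = \<Inter>F" using \<D>ch by blast
      with \<open>A \<in> \<D>\<close> \<open>\<Inter>F \<in> \<D>\<close> show ?case by auto
    qed auto
    have "K \<inter> \<Inter>\<D> \<noteq> {}"
    proof (rule compact_imp_fip[OF cpt(1)])
      show "closed T" if "T \<in> \<D>" for T using that \<D> by (auto simp: X_def)
      show "K \<inter> \<Inter>F \<noteq> {}" if "finite F" "F \<subseteq> \<D>" for F
      proof (cases "F = {}")
        case False
        then have "\<Inter>F \<in> X" using fin that \<D> by blast
        then show ?thesis by (auto simp: X_def)
      qed (use cpt in simp)
    qed
    moreover have "closed (\<Inter>\<D>)" using \<D> by (intro closed_Inter) (auto simp: X_def)
    moreover have "\<Inter>\<D> \<subseteq> K" using \<D> unfolding X_def by blast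
    moreover have "f ` \<Inter>\<D> \<subseteq> \<Inter>\<D>" using \<D>(1) unfolding X_def by blast
    ultimately have "\<Inter>\<D> \<in> X"
      by (auto simp: X_def)
    moreover have "\<Union>\<C> = - \<Inter>\<D>" by (auto simp: \<D>_def)
    ultimately show "\<Union>\<C> \<in> uminus ` X" by blast
  qed
  then obtain M where M: "M \<in> X" "\<And>C. C \<in> X \<Longrightarrow> C \<subseteq> M \<Longrightarrow> C = M"
    by (auto simp: image_iff)
  show thesis
    using M by (intro that[of M]) (auto simp: X_def)
qed

section \<open>Birkhoff sums and the cohomological equation\<close>

definition birkhoff_sum :: "('a \<Rightarrow> 'a) \<Rightarrow> ('a \<Rightarrow> real) \<Rightarrow> nat \<Rightarrow> 'a \<Rightarrow> real" where
  "birkhoff_sum f w n z = (\<Sum>k<n. w ((f ^^ k) z))"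

lemma birkhoff_sum_0 [simp]: "birkhoff_sum f w 0 z = 0"
  by (simp add: birkhoff_sum_def)

lemma birkhoff_sum_Suc: "birkhoff_sum f w (Suc n) z = birkhoff_sum f w n z + w ((f ^^ n) z)"
  by (simp add: birkhoff_sum_def)

lemma birkhoff_sum_add:
  "birkhoff_sum f w (m + n) z = birkhoff_sum f w m z + birkhoff_sum f w n ((f ^^ m) z)"
proof (induction n)
  case (Suc n)
  have "(f ^^ (m + n)) z = (f ^^ n) ((f ^^ m) z)"
    by (simp add: funpow_add add.commute[of m])
  with Suc show ?case by (simp add: birkhoff_sum_Suc)
qed simp

lemma birkhoff_sum_diff_const:
  "birkhoff_sum f (\<lambda>z. w z - r) n z = birkhoff_sum f w n z - real n * r"
  by (simp add: birkhoff_sum_def sum_subtractf)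

lemma continuous_on_funpow:
  assumes "continuous_on M f" "f ` M \<subseteq> M"
  shows "continuous_on M (f ^^ n) \<and> (f ^^ n) ` M \<subseteq> M"
proof (induction n)
  case (Suc n)
  then have "continuous_on M (f \<circ> (f ^^ n))"
    using assms by (intro continuous_on_compose) (auto intro: continuous_on_subset)
  with Suc assms show ?case by auto
qed simp

lemma continuous_on_birkhoff_sum:
  assumes "continuous_on M f" "f ` M \<subseteq> M" "continuous_on M w"
  shows "continuous_on M (birkhoff_sum f w n)"
  unfolding birkhoff_sum_def
  by (intro continuous_on_sum continuous_on_compose2[OF assms(3)])
     (use continuous_on_funpow[OF assms(1,2)] in auto)

text \<open>Gottschalk and Hedlund: the supremum of the Birkhoff sums is lower semicontinuous, the infimum
  upper semicontinuous, and by minimality their difference is constant.\<close>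

theorem gottschalk_hedlund:
  fixes f :: "'a::t2_space \<Rightarrow> 'a" and w :: "'a \<Rightarrow> real"
  assumes M: "closed M" "M \<noteq> {}" "f ` M \<subseteq> M"
    and minimal: "\<And>C. C \<subseteq> M \<Longrightarrow> closed C \<Longrightarrow> C \<noteq> {} \<Longrightarrow> f ` C \<subseteq> C \<Longrightarrow> C = M"
    and cont: "continuous_on M f" "continuous_on M w"
    and bound: "\<And>z n. z \<in> M \<Longrightarrow> \<bar>birkhoff_sum f w n z\<bar> \<le> B"
  obtains W where "continuous_on M W" "\<And>z. z \<in> M \<Longrightarrow> W (f z) = W z - w z"
proof -
  let ?S = "birkhoff_sum f w"
  define U where "U z = (SUP n. ?S n z)" for z
  define L where "L z = (INF n. ?S n z)" for z
  have bdd: "bdd_above (range (\<lambda>n. ?S n z))" "bdd_below (range (\<lambda>n. ?S n z))" if "z \<in> M" for z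
    using bound[OF that] by (auto intro!: bdd_aboveI[of _ B] bdd_belowI[of _ "- B"] simp: abs_le_iff minus_le_iff)
  have U: "?S n z \<le> U z" and L: "L z \<le> ?S n z" if "z \<in> M" for n z
    unfolding U_def L_def using bdd[OF that] by (auto intro: cSUP_upper cINF_lower)
  have fM: "f z \<in> M" if "z \<in> M" for z using that M by blast
  have shift: "?S n (f z) = ?S (Suc n) z - w z" for n z
    using birkhoff_sum_add[of f w 1 n z] by (simp add: birkhoff_sum_Suc)
  \<comment> \<open>The sums starting at \<open>f z\<close> are, up to the constant
    \<open>w z\<close>, those starting at \<open>z\<close> without the sum of length 0. Hence
    \<open>U - L\<close> does not increase along \<open>f\<close>.\<close>
  have Uf: "U (f z) \<le> U z - w z" and Lf: "L (f z) \<ge> L z - w z" if "z \<in> M" for z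
    using U[OF that] L[OF that]
    by (auto simp: U_def[of "f z"] L_def[of "f z"] shift intro!: cSUP_least cINF_greatest)
  have contS: "continuous_on M (?S n)" for n
    using continuous_on_birkhoff_sum[OF cont(1) M(3) cont(2)] .
  \<comment> \<open>Sublevel sets of the oscillation \<open>U - L\<close> are closed, since it is a
    supremum of continuous functions, and forward invariant. By minimality each is empty or all of
    \<open>M\<close>.\<close>
  define G where "G c = {z \<in> M. U z - L z \<le> c}" for c
  have G_eq: "G c = (\<Inter>m. \<Inter>n. {z \<in> M. ?S m z - ?S n z \<le> c})" for c
  proof -
    have "U z - L z \<le> c \<longleftrightarrow> (\<forall>m n. ?S m z - ?S n z \<le> c)" if "z \<in> M" for z
    proof
      assume "\<forall>m n. ?S m z - ?S n z \<le> c"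
      then have "?S m z - c \<le> L z" for m
        unfolding L_def by (intro cINF_greatest) (auto simp: algebra_simps)
      then have "U z \<le> L z + c"
        unfolding U_def by (intro cSUP_least) (auto simp: algebra_simps)
      then show "U z - L z \<le> c" by simp
    qed (use U[OF that] L[OF that] in \<open>smt (verit)\<close>)
    then show ?thesis by (auto simp: G_def)
  qed
  have "closed (G c)" for c
    unfolding G_eq
    by (intro closed_INT ballI continuous_closed_preimage[of M _ "{..c}", OF _ M(1), unfolded vimage_def Int_def, simplified])
       (intro continuous_intros contS)
  then have G_all: "G c = M" if "G c \<noteq> {}" for c
    using that Uf Lf fM by (intro minimal) (force simp: G_def)+
  obtain z0 where z0: "z0 \<in> M" using M by blast
  define \<kappa> where "\<kappa> = U z0 - L z0"
  have const: "U z - L z = \<kappa>" if z: "z \<in> M" for z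
  proof (rule antisym)
    have "z0 \<in> G \<kappa>" using z0 by (simp add: G_def \<kappa>_def)
    then have "z \<in> G \<kappa>" using G_all z by blast
    then show "U z - L z \<le> \<kappa>" by (simp add: G_def)
    have "z \<in> G (U z - L z)" using z by (simp add: G_def)
    then have "z0 \<in> G (U z - L z)" using G_all z0 by blast
    then show "\<kappa> \<le> U z - L z" by (simp add: G_def \<kappa>_def)
  qed
  \<comment> \<open>Constant oscillation leaves no room for strict inequality in \<open>Uf\<close>
    or \<open>Lf\<close>.\<close>
  have "U (f z) = U z - w z" if "z \<in> M" for z
    using Uf[OF that] Lf[OF that] const[OF that] const[OF fM[OF that]] by linarith
  moreover have "continuous_on M U"
    unfolding continuous_on_def
  proof (intro ballI order_tendstoI)
    fix z a assume z: "z \<in> M"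
    have tend: "(?S n \<longlongrightarrow> ?S n z) (at z within M)" for n
      using contS z by (simp add: continuous_on_def)
    have ev: "\<forall>\<^sub>F y in at z within M. y \<in> M" by (simp add: eventually_at_filter)
    {
      assume "a < U z"
      then obtain n where "a < ?S n z"
        unfolding U_def using bdd(1)[OF z] by (subst (asm) less_cSUP_iff) auto
      then have "\<forall>\<^sub>F y in at z within M. a < ?S n y" by (rule order_tendstoD(1)[OF tend])
      with ev show "\<forall>\<^sub>F y in at z within M. a < U y"
        by eventually_elim (use U less_le_trans in blast)
    }
    {
      assume "a > U z"
      then have "L z < a - \<kappa>" using const[OF z] by linarith
      then obtain n where "?S n z < a - \<kappa>"
        unfolding L_def using bdd(2)[OF z] by (subst (asm) cINF_less_iff) auto
      then have "\<forall>\<^sub>F y in at z within M. ?S n y < a - \<kappa>" by (rule order_tendstoD(2)[OF tend])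
      with ev show "\<forall>\<^sub>F y in at z within M. U y < a"
        by eventually_elim (use L const in \<open>smt (verit)\<close>)
    }
  qed
  ultimately show thesis using that by blast
qed

text \<open>Estimating \<open>a (m * n)\<close> in two ways gives
  \<open>(a m - c) / m \<le> (a n + c) / n\<close> for all positive \<open>m\<close>,
  \<open>n\<close>; any \<open>r\<close> separating the two families works, and the supremum of the
  left sides is one.\<close>

lemma quasi_additive_linear:
  fixes a :: "nat \<Rightarrow> real"
  assumes "\<And>m n. \<bar>a (m + n) - a m - a n\<bar> \<le> c"
  shows "\<exists>r. \<forall>n. \<bar>a n - real n * r\<bar> \<le> c"
proof -
  have up: "a (m * n) \<le> real m * (a n + c) - c" if "m \<ge> 1" for m n
    using that
  proof (induction m rule: dec_induct)
    case (step m)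
    then show ?case using assms[of n "m * n"] by (simp add: algebra_simps)
  qed simp
  have low: "a (m * n) \<ge> real m * (a n - c) + c" if "m \<ge> 1" for m n
    using that
  proof (induction m rule: dec_induct)
    case (step m)
    then show ?case using assms[of n "m * n"] by (simp add: algebra_simps)
  qed simp
  have c: "c \<ge> 0" using assms[of 0 0] by linarith
  have cmp: "(a m - c) / m \<le> (a n + c) / n" if "m \<ge> 1" "n \<ge> 1" for m n :: nat
  proof -
    have "real n * (a m - c) + c \<le> real m * (a n + c) - c"
      using low[OF that(2), of m] up[OF that(1), of n] by (simp add: mult.commute)
    with c that show ?thesis by (simp add: field_simps)
  qed
  define r where "r = (SUP m\<in>{1..}. (a m - c) / real m)"
  have "bdd_above ((\<lambda>m. (a m - c) / real m) ` {1..})"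
    using cmp[of _ 1] by (intro bdd_aboveI[of _ "(a 1 + c) / 1"]) auto
  then have 1: "(a n - c) / n \<le> r" if "n \<ge> 1" for n
    unfolding r_def using that by (intro cSUP_upper) auto
  have 2: "r \<le> (a n + c) / n" if "n \<ge> 1" for n
    unfolding r_def using that cmp by (intro cSUP_least) auto
  have "\<bar>a n - real n * r\<bar> \<le> c" for n
  proof (cases "n = 0")
    case True
    then show ?thesis using assms[of 0 0] by simp
  next
    case False
    with 1[of n] 2[of n] show ?thesis by (simp add: field_simps abs_le_iff)
  qed
  then show ?thesis by blast
qed

section \<open>Forced circle maps with a real displacement\<close>

text \<open>A real displacement \<open>w\<close> amounts to a choice of lift, whose orbits are then
  Birkhoff sums. Injectivity on fibres will make the fibre lifts monotone.\<close>

locale forced_circle_map =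
  fixes \<omega> :: real and w :: "circle \<times> circle \<Rightarrow> real"
  assumes cont_w: "continuous_on UNIV w"
    and inj_fiber: "inj (\<lambda>\<xi>. \<xi> + circle_of (w (\<theta>, \<xi>)))"
begin

definition f :: "circle \<times> circle \<Rightarrow> circle \<times> circle" where
  "f z = (fst z + circle_of \<omega>, snd z + circle_of (w z))"

abbreviation S :: "nat \<Rightarrow> circle \<times> circle \<Rightarrow> real" where
  "S \<equiv> birkhoff_sum f w"

lemma continuous_on_f: "continuous_on UNIV f"
proof -
  have "continuous_on UNIV (\<lambda>z. circle_of (w z))"
    by (rule continuous_on_compose2[OF continuous_on_circle_of[of UNIV] cont_w]) simp
  then show ?thesis
    unfolding f_def by (intro continuous_intros)
qed

lemma continuous_on_S: "continuous_on UNIV (S n)"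
  by (rule continuous_on_birkhoff_sum[OF continuous_on_f _ cont_w]) simp

lemma funpow_f: "(f ^^ n) z = (fst z + circle_of (real n * \<omega>), snd z + circle_of (S n z))"
  by (induction n)
     (simp_all add: circle_of_0 f_def birkhoff_sum_Suc circle_of_add algebra_simps)

text \<open>A continuous injective real function is strictly monotone, and the shift by 1 from 0 to
  1 fixes the orientation.\<close>

lemma fiber_lift_mono:
  assumes "x \<le> y"
  shows "x + w (\<theta>, circle_of x) \<le> y + w (\<theta>, circle_of y)"
proof -
  define G where "G x = x + w (\<theta>, circle_of x)" for x
  have "inj G"
  proof (rule injI)
    fix x y assume eq: "G x = G y"
    have "circle_of x + circle_of (w (\<theta>, circle_of x)) = circle_of y + circle_of (w (\<theta>, circle_of y))"
      using arg_cong[OF eq, of circle_of] unfolding G_def circle_of_add .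
    then have "circle_of x = circle_of y"
      by (rule injD[OF inj_fiber])
    with eq show "x = y" by (simp add: G_def)
  qed
  moreover have "continuous_on UNIV G"
    unfolding G_def by (intro continuous_intros continuous_on_compose2[OF cont_w]) auto
  ultimately have "strict_mono G \<or> strict_antimono_on UNIV G"
    using injective_eq_monotone_map[OF is_interval_univ, of G] by simp
  moreover have "G 0 < G 1"
    using circle_of_eq_iff[of 1 0] by (simp add: G_def)
  ultimately have "strict_mono G"
    using monotone_onD[of UNIV "(<)" "(>)" G 0 1] by auto
  then have "G x \<le> G y" using assms by (simp add: strict_mono_less_eq)
  then show ?thesis by (simp add: G_def)
qed

lemma iterated_lift_mono:
  assumes "x \<le> y"
  shows "x + S n (\<theta>, circle_of x) \<le> y + S n (\<theta>, circle_of y)"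
proof (induction n)
  case (Suc n)
  have "(f ^^ n) (\<theta>, circle_of a) = (\<theta> + circle_of (real n * \<omega>), circle_of (a + S n (\<theta>, circle_of a)))" for a
    by (simp add: funpow_f circle_of_add)
  then show ?case
    using fiber_lift_mono[OF Suc] by (simp add: birkhoff_sum_Suc add.assoc)
qed (use assms in simp)

text \<open>Some lift \<open>y\<close> of \<eta> lies between \<open>x\<close> and
  \<open>x + 1\<close>. Monotone iterates preserve this order, and the displacement is the same at
  \<open>x\<close> and \<open>x + 1\<close>.\<close>

lemma S_fiber_bound: "\<bar>S n (\<theta>, \<xi>) - S n (\<theta>, \<eta>)\<bar> \<le> 1"
proof -
  obtain x where x: "circle_of x = \<xi>" using circle_of_surj by blast
  obtain y0 where y0: "circle_of y0 = \<eta>" using circle_of_surj by blast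
  define y where "y = y0 + of_int \<lceil>x - y0\<rceil>"
  have y: "circle_of y = \<eta>"
    unfolding y0[symmetric] circle_of_eq_iff by (simp add: y_def)
  have xy: "x \<le> y" "y \<le> x + 1"
    unfolding y_def by linarith+
  have "circle_of (x + 1) = \<xi>"
    unfolding x[symmetric] circle_of_eq_iff by simp
  then show ?thesis
    using iterated_lift_mono[OF xy(1), of n \<theta>] iterated_lift_mono[OF xy(2), of n \<theta>] x y xy
    by (simp add: abs_le_iff)
qed

text \<open>The values of \<open>h\<close> on the fibre of a minimal set fill the circle, whereas
  contraction splits that fibre into two pieces on each of which \<open>h\<close> varies by less
  than 1/4. Three points at mutual distance 1/3 do not fit.\<close>

theorem not_bounded_of_contraction:
  assumes indep: "\<And>a b c :: int. of_int a + of_int b * \<omega> + of_int c * r = 0 \<Longrightarrow> a = 0 \<and> b = 0 \<and> c = 0"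
    and contraction: "\<And>e. e > 0 \<Longrightarrow> \<exists>\<theta> n P. (\<forall>\<xi>\<in>P. \<forall>\<eta>\<in>P. dist \<xi> \<eta> \<le> e) \<and>
      (\<forall>\<xi>\<in>-P. \<forall>\<eta>\<in>-P. dist ((f ^^ n) (\<theta>, \<xi>)) ((f ^^ n) (\<theta>, \<eta>)) \<le> e)"
  shows "\<not> (\<forall>n z. \<bar>S n z - real n * r\<bar> \<le> C)"
proof
  assume bound: "\<forall>n z. \<bar>S n z - real n * r\<bar> \<le> C"
  have cpt: "compact (UNIV :: (circle \<times> circle) set)"
    using compact_Times[OF compact_UNIV_circle compact_UNIV_circle] by simp
  obtain M where M: "closed M" "M \<noteq> {}" "f ` M \<subseteq> M"
    and minimal: "\<And>C. C \<subseteq> M \<Longrightarrow> closed C \<Longrightarrow> C \<noteq> {} \<Longrightarrow> f ` C \<subseteq> C \<Longrightarrow> C = M"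
    using compact_minimal_invariant_set[OF cpt, of f] by (metis UNIV_not_empty subset_UNIV)
  have cptM: "compact M"
    using compact_Int_closed[OF cpt M(1)] by simp
  have bound': "\<bar>birkhoff_sum f (\<lambda>z. w z - r) n z\<bar> \<le> C" for n z
    unfolding birkhoff_sum_diff_const using bound by blast
  have contM: "continuous_on M f" "continuous_on M (\<lambda>z. w z - r)"
    using continuous_on_f cont_w by (auto intro!: continuous_intros intro: continuous_on_subset)
  obtain W where W: "continuous_on M W" "\<And>z. z \<in> M \<Longrightarrow> W (f z) = W z - (w z - r)"
  proof (rule gottschalk_hedlund[OF M _ contM bound'])
    show "C = M" if "C \<subseteq> M" "closed C" "C \<noteq> {}" "f ` C \<subseteq> C" for C
      using that by (rule minimal)
  qed (rule that)
  text \<open>\<open>h\<close> semiconjugates \<open>f\<close> on \<open>M\<close> to rotation by \<open>r\<close> in the fibres.\<close>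
  define h where "h z = snd z + circle_of (W z)" for z
  have hf: "h (f z) = h z + circle_of r" if "z \<in> M" for z
    using W(2)[OF that]
    by (simp add: h_def f_def circle_of_minus circle_of_add flip: diff_diff_eq2)
  have fnM: "(f ^^ n) z \<in> M" if "z \<in> M" for n z
    using that M(3) by (induction n) auto
  have hfn: "h ((f ^^ n) z) = h z + circle_of (real n * r)" if "z \<in> M" for n z
    using fnM[OF that] by (induction n) (simp_all add: hf circle_of_0 circle_of_add algebra_simps)
  have cont_h: "continuous_on M h"
    unfolding h_def
    by (intro continuous_intros continuous_on_compose2[OF continuous_on_circle_of[of UNIV] W(1)]) simp
  then have "compact ((\<lambda>z. (fst z, h z)) ` M)"
    by (intro compact_continuous_image cptM continuous_intros)
  then have closed_img: "closed ((\<lambda>z. (fst z, h z)) ` M)"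
    by (rule compact_imp_closed)
  \<comment> \<open>Rational independence makes the orbit of \<open>(fst z, h z)\<close> under the
    translation dense in the torus, and the compact image of \<open>M\<close> contains it.\<close>
  have surj: "\<exists>\<xi>. (\<theta>, \<xi>) \<in> M \<and> h (\<theta>, \<xi>) = \<beta>" for \<theta> \<beta>
  proof -
    obtain z where z: "z \<in> M" using M by blast
    have "(\<theta>, \<beta>) \<in> closure ((\<lambda>z. (fst z, h z)) ` M)"
      unfolding closure_approachable
    proof (intro allI impI)
      fix e :: real assume e: "e > 0"
      obtain n :: nat where n: "dist (circle_of (real n * \<omega>)) (\<theta> - fst z) < e / 2"
        "dist (circle_of (real n * r)) (\<beta> - h z) < e / 2"
        using translation_orbit_dense[of \<omega> r "e / 2" "\<theta> - fst z" "\<beta> - h z", OF indep] e by auto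
      let ?y = "(f ^^ n) z"
      have "dist (fst ?y) \<theta> < e / 2"
        using n(1) unfolding funpow_f fst_conv
        by (subst (asm) dist_circle_add_left[of "fst z", symmetric]) simp
      moreover have "dist (h ?y) \<beta> < e / 2"
        using n(2) unfolding hfn[OF z]
        by (subst (asm) dist_circle_add_left[of "h z", symmetric]) simp
      ultimately have "dist (fst ?y, h ?y) (\<theta>, \<beta>) < e"
        using sqrt_sum_squares_le_sum_abs[of "dist (fst ?y) \<theta>" "dist (h ?y) \<beta>"]
        by (simp add: dist_Pair_Pair)
      with fnM[OF z] show "\<exists>y\<in>(\<lambda>z. (fst z, h z)) ` M. dist y (\<theta>, \<beta>) < e" by blast
    qed
    then show ?thesis
      using closed_img by (auto simp: closure_closed)
  qed
  have "uniformly_continuous_on M h"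
    by (rule compact_uniformly_continuous[OF cont_h cptM])
  then obtain d where d: "d > 0" "\<And>y z. y \<in> M \<Longrightarrow> z \<in> M \<Longrightarrow> dist y z < d \<Longrightarrow> dist (h y) (h z) < 1/4"
    unfolding uniformly_continuous_on_def by (metis zero_less_divide_1_iff zero_less_numeral)
  obtain \<theta> n P where P: "\<And>\<xi> \<eta>. \<xi> \<in> P \<Longrightarrow> \<eta> \<in> P \<Longrightarrow> dist \<xi> \<eta> \<le> d / 2"
    and Q: "\<And>\<xi> \<eta>. \<xi> \<notin> P \<Longrightarrow> \<eta> \<notin> P \<Longrightarrow> dist ((f ^^ n) (\<theta>, \<xi>)) ((f ^^ n) (\<theta>, \<eta>)) \<le> d / 2"
    using contraction[of "d / 2"] d(1) by (metis ComplI half_gt_zero)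
  obtain x where x: "\<And>\<beta>. (\<theta>, x \<beta>) \<in> M" "\<And>\<beta>. h (\<theta>, x \<beta>) = \<beta>"
    using surj[of \<theta>] by metis
  \<comment> \<open>Outside \<open>P\<close> the points become close only after \<open>n\<close>
    steps, but \<open>h\<close> turns these steps into a rotation, which preserves the distance of
    the values of \<open>h\<close>.\<close>
  have near: "dist \<beta> \<gamma> < 1/4" if same: "x \<beta> \<in> P \<longleftrightarrow> x \<gamma> \<in> P" for \<beta> \<gamma>
  proof (cases "x \<beta> \<in> P")
    case True
    then have "dist (\<theta>, x \<beta>) (\<theta>, x \<gamma>) < d"
      using P[of "x \<beta>" "x \<gamma>"] same d(1) by (simp add: dist_Pair_Pair)
    then show ?thesis using d(2) x by metis
  next
    case False
    then have "dist ((f ^^ n) (\<theta>, x \<beta>)) ((f ^^ n) (\<theta>, x \<gamma>)) < d"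
      using Q[of "x \<beta>" "x \<gamma>"] same d(1) by simp
    then have "dist (h ((f ^^ n) (\<theta>, x \<beta>))) (h ((f ^^ n) (\<theta>, x \<gamma>))) < 1/4"
      using d(2) fnM x(1) by blast
    then show ?thesis by (simp add: hfn x)
  qed
  text \<open>Two of the three equidistant points lie on the same side of \<open>P\<close>.\<close>
  have far: "dist (circle_of 0) (circle_of (1/3)) = 1/3" "dist (circle_of (1/3)) (circle_of (2/3)) = 1/3"
    by (simp_all add: dist_circle_of_small)
  have "dist (circle_of 0) (circle_of (2/3)) = dist (circle_of 1) (circle_of (2/3))"
    using circle_of_eq_iff[of 0 1] by simp
  also have "\<dots> = 1/3" by (simp add: dist_circle_of_small)
  finally have far': "dist (circle_of 0) (circle_of (2/3)) = 1/3" .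
  show False
    using near[of "circle_of 0" "circle_of (1/3)"] near[of "circle_of (1/3)" "circle_of (2/3)"]
      near[of "circle_of 0" "circle_of (2/3)"] far far' by fastforce
qed

end

section \<open>Invariance of Lebesgue measure and return times\<close>

text \<open>The Borel measure underlying \<open>circle_lebesgue\<close>; measure estimates are made
  here, before completion.\<close>

definition circle_borel :: "circle measure" where
  "circle_borel = distr (restrict_space lborel {0..<1}) borel circle_of"

lemma circle_lebesgue_eq: "circle_lebesgue = completion circle_borel"
  by (simp add: circle_lebesgue_def circle_borel_def)

lemma sets_circle_borel [simp, measurable_cong]: "sets circle_borel = sets borel"
  and space_circle_borel [simp]: "space circle_borel = UNIV"
  and space_circle_lebesgue [simp]: "space circle_lebesgue = UNIV"
  by (simp_all add: circle_borel_def circle_lebesgue_def)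

lemma borel_measurable_circle_of [measurable]: "circle_of \<in> borel_measurable borel"
  by (intro borel_measurable_continuous_onI continuous_on_circle_of)

lemma emeasure_circle_borel:
  assumes "U \<in> sets borel"
  shows "emeasure circle_borel U = emeasure lborel (circle_of -` U \<inter> {0..<1})"
proof -
  have "circle_of \<in> restrict_space lborel {0..<1} \<rightarrow>\<^sub>M borel"
    by (intro measurable_restrict_space1) simp
  then have "emeasure circle_borel U
      = emeasure (restrict_space lborel {0..<1}) (circle_of -` U \<inter> space (restrict_space lborel {0..<1}))"
    unfolding circle_borel_def using assms by (rule emeasure_distr)
  then show ?thesis
    by (simp add: space_restrict_space emeasure_restrict_space)
qed

lemma prob_circle_borel: "emeasure circle_borel UNIV = 1"
  by (subst emeasure_circle_borel) auto

lemma emeasure_lborel_translate: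
  assumes "V \<in> sets borel"
  shows "emeasure lborel {x::real. x + s \<in> V} = emeasure lborel V"
proof -
  have "emeasure lborel V = emeasure (distr lborel borel ((+) s)) V"
    using lborel_distr_plus[of s] by simp
  also have "\<dots> = emeasure lborel ((+) s -` V \<inter> space lborel)"
    by (rule emeasure_distr) (use assms in auto)
  also have "(+) s -` V \<inter> space lborel = {x. x + s \<in> V}"
    by (auto simp: add.commute)
  finally show ?thesis by simp
qed

lemma sets_circle_translate:
  fixes a :: circle
  assumes "U \<in> sets borel"
  shows "{\<theta>. \<theta> + a \<in> U} \<in> sets borel"
  using measurable_sets[of "\<lambda>\<theta>. \<theta> + a" borel borel U] assms
  by (simp add: vimage_def borel_measurable_continuous_onI continuous_intros)

text \<open>Translation by \<open>s\<close> in [0, 1) moves the fundamental interval to [s, 1 + s).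
  The part beyond 1 returns to [0, s) by periodicity.\<close>

lemma emeasure_circle_borel_translate:
  assumes U: "U \<in> sets borel"
  shows "emeasure circle_borel {\<theta>. \<theta> + a \<in> U} = emeasure circle_borel U"
proof -
  obtain s0 where s0: "circle_of s0 = a" using circle_of_surj by blast
  define s where "s = frac s0"
  have s: "0 \<le> s" "s < 1" "circle_of s = a"
    using frac_lt_1[of s0] unfolding s0[symmetric] s_def circle_of_eq_iff frac_def by auto
  define V where "V = circle_of -` U"
  have V [measurable]: "V \<in> sets borel"
    unfolding V_def using measurable_sets[OF borel_measurable_circle_of U] by simp
  have per: "x + 1 \<in> V \<longleftrightarrow> x \<in> V" for x
    using circle_of_eq_iff[of "x + 1" x] by (simp add: V_def)
  have U': "{\<theta>. \<theta> + a \<in> U} \<in> sets borel"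
    by (rule sets_circle_translate[OF U])
  have "emeasure circle_borel {\<theta>. \<theta> + a \<in> U} = emeasure lborel {x. x + s \<in> V \<inter> {s..<1 + s}}"
    by (subst emeasure_circle_borel[OF U']) (rule arg_cong[of _ _ "emeasure lborel"],
      auto simp: V_def circle_of_add s)
  also have "\<dots> = emeasure lborel (V \<inter> {s..<1 + s})"
    by (rule emeasure_lborel_translate) simp
  also have "V \<inter> {s..<1 + s} = (V \<inter> {s..<1}) \<union> (V \<inter> {1..<1 + s})"
    using s by auto
  also have "emeasure lborel \<dots> = emeasure lborel (V \<inter> {s..<1}) + emeasure lborel (V \<inter> {1..<1 + s})"
    by (rule plus_emeasure[symmetric]) auto
  also have "emeasure lborel (V \<inter> {1..<1 + s}) = emeasure lborel {x. x + 1 \<in> V \<inter> {1..<1 + s}}"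
    by (rule emeasure_lborel_translate[symmetric]) simp
  also have "{x. x + 1 \<in> V \<inter> {1..<1 + s}} = V \<inter> {0..<s}"
    by (auto simp: per)
  also have "emeasure lborel (V \<inter> {s..<1}) + emeasure lborel (V \<inter> {0..<s})
      = emeasure lborel ((V \<inter> {s..<1}) \<union> (V \<inter> {0..<s}))"
    by (rule plus_emeasure) auto
  also have "(V \<inter> {s..<1}) \<union> (V \<inter> {0..<s}) = V \<inter> {0..<1}"
    using s by auto
  finally show ?thesis by (simp add: emeasure_circle_borel[OF U] V_def)
qed

lemma emeasure_circle_borel_ball:
  assumes "d > 0"
  shows "emeasure circle_borel (ball c d) > 0"
proof -
  obtain x0 where x0: "circle_of x0 = c" using circle_of_surj by blast
  define x where "x = frac x0"
  have x: "0 \<le> x" "x < 1" "circle_of x = c"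
    using frac_lt_1[of x0] unfolding x0[symmetric] x_def circle_of_eq_iff frac_def by auto
  \<comment> \<open>The cut at 1 keeps the interval inside the fundamental domain; it is
    nondegenerate because \<open>x\<close> < 1.\<close>
  define y where "y = min 1 (x + d)"
  have "0 < emeasure lborel {x..<y}" using x assms by (simp add: y_def)
  also have "\<dots> \<le> emeasure lborel (circle_of -` ball c d \<inter> {0..<1})"
  proof (rule emeasure_mono)
    show "{x..<y} \<subseteq> circle_of -` ball c d \<inter> {0..<1}"
    proof
      fix z assume z: "z \<in> {x..<y}"
      then have "dist (circle_of x) (circle_of z) < d"
        using dist_circle_of_le[of x z] by (auto simp: y_def dist_real_def)
      with z x show "z \<in> circle_of -` ball c d \<inter> {0..<1}" by (auto simp: y_def)
    qed
    have "circle_of -` ball c d \<in> sets borel"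
      using measurable_sets[OF borel_measurable_circle_of, of "ball c d"] by simp
    then show "circle_of -` ball c d \<inter> {0..<1} \<in> sets lborel" by simp
  qed
  also have "\<dots> = emeasure circle_borel (ball c d)"
    by (rule emeasure_circle_borel[symmetric]) simp
  finally show ?thesis .
qed

text \<open>The return times of a set of positive measure are relatively dense: otherwise translates of it
  could be added to a maximal disjoint family of translates.\<close>

lemma return_times_syndetic:
  assumes E: "E \<in> sets borel" "emeasure circle_borel E > 0"
  obtains K where "\<And>n. \<exists>m \<theta>. n \<le> m \<and> m \<le> n + K \<and> \<theta> \<in> E \<and> \<theta> + circle_of (real m * \<omega>) \<in> E"
proof -
  let ?E = "\<lambda>j. {\<theta>. \<theta> + circle_of (real j * \<omega>) \<in> E}"
  interpret finite_measure circle_borel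
    by standard (simp add: prob_circle_borel)
  have pos: "measure circle_borel E > 0" using E(2) by (simp add: emeasure_eq_measure)
  have eqE: "measure circle_borel (?E j) = measure circle_borel E" for j
    using emeasure_circle_borel_translate[OF E(1)] by (simp add: emeasure_eq_measure)
  define Q where "Q J \<longleftrightarrow> finite J \<and> disjoint_family_on ?E J" for J
  have bound: "real (card J) \<le> 1 / measure circle_borel E" if "Q J" for J
  proof -
    have "real (card J) * measure circle_borel E = (\<Sum>j\<in>J. measure circle_borel (?E j))"
      by (simp add: eqE)
    also have "\<dots> = measure circle_borel (\<Union>j\<in>J. ?E j)"
      using that by (intro finite_measure_finite_Union[symmetric])
        (auto simp: Q_def sets_circle_translate[OF E(1)])
    also have "\<dots> \<le> measure circle_borel UNIV"
      by (intro finite_measure_mono) auto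
    also have "\<dots> = 1" using prob_circle_borel by (simp add: emeasure_eq_measure)
    finally show ?thesis using pos by (simp add: field_simps)
  qed
  have "\<exists>J. Q J \<and> (\<forall>J'. Q J' \<longrightarrow> card J' \<le> card J)"
  proof (rule ex_has_greatest_nat)
    show "Q {}" by (simp add: Q_def disjoint_family_on_def)
    show "\<forall>J. Q J \<longrightarrow> card J < Suc (nat \<lfloor>1 / measure circle_borel E\<rfloor>)"
      using bound by (auto simp: less_Suc_eq_le intro!: le_nat_floor)
  qed
  then obtain J where J: "Q J" "\<And>J'. Q J' \<Longrightarrow> card J' \<le> card J" by blast
  obtain N where N: "\<And>j. j \<in> J \<Longrightarrow> j \<le> N"
    using J(1) finite_nat_set_iff_bounded_le[of J] by (auto simp: Q_def)
  show thesis
  proof (rule that)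
    fix n
    \<comment> \<open>This index lies beyond \<open>J\<close>, and its difference to any member of
      \<open>J\<close> is between \<open>n\<close> and \<open>n + Suc N\<close>.\<close>
    let ?n = "n + Suc N"
    have "?n \<notin> J" using N[of ?n] by auto
    then have "\<not> Q (insert ?n J)" using J(2)[of "insert ?n J"] J(1) by (auto simp: Q_def)
    then have "\<exists>j\<in>J. ?E j \<inter> ?E ?n \<noteq> {}"
      using J(1) \<open>?n \<notin> J\<close> by (auto simp: Q_def disjoint_family_on_insert)
    then obtain j t where j: "j \<in> J" "t + circle_of (real j * \<omega>) \<in> E" "t + circle_of (real ?n * \<omega>) \<in> E"
      by blast
    define m where "m = ?n - j"
    have m: "?n = j + m" "n \<le> m" "m \<le> n + Suc N" using N[OF j(1)] by (auto simp: m_def)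
    have "t + circle_of (real j * \<omega>) + circle_of (real m * \<omega>) \<in> E"
      using j(3) unfolding m(1) by (simp add: algebra_simps circle_of_add)
    with j(2) m show "\<exists>m \<theta>. n \<le> m \<and> m \<le> n + Suc N \<and> \<theta> \<in> E \<and> \<theta> + circle_of (real m * \<omega>) \<in> E"
      by blast
  qed
qed

section \<open>Sensitive dependence\<close>

context forced_circle_map
begin

text \<open>Lifts that are \<open>e\<close>-close move apart by less than 1/4 in one step, so they
  stay within 1/2, where the real difference equals the circle distance and is again at most
  \<open>e\<close>. Thus no integer jump ever occurs.\<close>

lemma close_orbits:
  obtains e where "e > 0"
    "\<And>z z' n. (\<And>n. dist ((f ^^ n) z) ((f ^^ n) z') \<le> e) \<Longrightarrow> \<bar>S n z - S n z'\<bar> \<le> 1"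
proof -
  have "compact (UNIV :: (circle \<times> circle) set)"
    using compact_Times[OF compact_UNIV_circle compact_UNIV_circle] by simp
  then have "uniformly_continuous_on UNIV w"
    by (rule compact_uniformly_continuous[OF cont_w])
  then obtain d where d: "d > 0" "\<And>y z. dist y z < d \<Longrightarrow> dist (w y) (w z) < 1/4"
    unfolding uniformly_continuous_on_def by (metis UNIV_I zero_less_divide_1_iff zero_less_numeral)
  define e where "e = min (d / 2) (1/8)"
  have e: "e > 0" "e < d" "e \<le> 1/8" using d by (auto simp: e_def)
  show thesis
  proof (rule that[OF e(1)])
    fix z z' n assume close: "\<And>n. dist ((f ^^ n) z) ((f ^^ n) z') \<le> e"
    have close_snd: "dist (snd ((f ^^ n) z)) (snd ((f ^^ n) z')) \<le> e" for n
      using dist_snd_le close order_trans by blast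
    obtain x where x: "circle_of x = snd z" using circle_of_surj by blast
    obtain x' where x': "circle_of x' = snd z'" "\<bar>x - x'\<bar> = dist (circle_of x) (snd z')"
      using circle_lift_near by blast
    have "\<bar>(x + S n z) - (x' + S n z')\<bar> \<le> e" for n
    proof (induction n)
      case 0
      then show ?case using close_snd[of 0] x x' by simp
    next
      case (Suc n)
      let ?X = "x + S (Suc n) z" and ?X' = "x' + S (Suc n) z'"
      have "\<bar>w ((f ^^ n) z) - w ((f ^^ n) z')\<bar> < 1/4"
        using d(2)[of "(f ^^ n) z" "(f ^^ n) z'"] close[of n] e by (simp add: dist_real_def)
      then have "\<bar>?X - ?X'\<bar> \<le> 1/2"
        using Suc e unfolding birkhoff_sum_Suc by linarith
      then have "\<bar>?X - ?X'\<bar> = dist (circle_of ?X) (circle_of ?X')"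
        by (simp add: dist_circle_of_small)
      also have "\<dots> \<le> e"
        using close_snd[of "Suc n"] unfolding funpow_f snd_conv circle_of_add x x' .
      finally show ?case .
    qed
    from this[of n] this[of 0] e show "\<bar>S n z - S n z'\<bar> \<le> 1"
      by simp
  qed
qed

text \<open>Starting later on the orbit of \<open>z0\<close> costs a second \<open>c\<close>,
  changing the point in a fibre costs 1, and continuity together with density of the base orbit
  reaches all other fibres.\<close>

lemma S_bounded_of_one_orbit:
  assumes irr: "\<omega> \<notin> \<rat>" and bound: "\<And>n. \<bar>S n z0 - real n * r\<bar> \<le> c"
  shows "\<bar>S n z - real n * r\<bar> \<le> 2 * c + 1"
proof -
  have along: "\<bar>S n ((f ^^ k) z0) - real n * r\<bar> \<le> 2 * c" for k n
    using bound[of "k + n"] bound[of k] by (simp add: birkhoff_sum_add algebra_simps abs_le_iff)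
  have on_line: "\<bar>S n (\<theta>, \<xi>) - real n * r\<bar> \<le> 2 * c + 1" for \<theta> \<xi>
  proof (rule ccontr)
    assume "\<not> ?thesis"
    then have "(\<theta>, \<xi>) \<in> {z. \<bar>S n z - real n * r\<bar> > 2 * c + 1}" by simp
    moreover have "open {z. \<bar>S n z - real n * r\<bar> > 2 * c + 1}"
      by (intro open_Collect_less continuous_intros continuous_on_S)
    ultimately obtain d where d: "d > 0" "\<And>y. dist y (\<theta>, \<xi>) < d \<Longrightarrow> \<bar>S n y - real n * r\<bar> > 2 * c + 1"
      unfolding open_dist by blast
    obtain t where t: "circle_of t = \<theta> - fst z0" using circle_of_surj by blast
    obtain h k where hk: "k > 0" "\<bar>of_int k * \<omega> - of_int h - t\<bar> < d"
      using sequence_of_fractional_parts_is_dense[OF irr d(1)] by metis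
    define m where "m = nat k"
    have m: "real m = of_int k" using hk(1) by (simp add: m_def)
    let ?\<theta> = "fst ((f ^^ m) z0)"
    have "dist (circle_of (real m * \<omega>)) (\<theta> - fst z0) < d"
      using infdist_Ints_le[of "of_int h" "real m * \<omega> - t"] hk(2)
      unfolding t[symmetric] dist_circle_of m by (simp add: algebra_simps)
    then have "dist ?\<theta> \<theta> < d"
      unfolding funpow_f fst_conv by (subst (asm) dist_circle_add_left[of "fst z0", symmetric]) simp
    then have "dist (?\<theta>, \<xi>) (\<theta>, \<xi>) < d" by (simp add: dist_Pair_Pair)
    then have "\<bar>S n (?\<theta>, \<xi>) - real n * r\<bar> > 2 * c + 1" by (rule d(2))
    moreover have "\<bar>S n (?\<theta>, snd ((f ^^ m) z0)) - S n (?\<theta>, \<xi>)\<bar> \<le> 1"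
      by (rule S_fiber_bound)
    ultimately show False using along[of n m] by simp
  qed
  show ?thesis using on_line[of "fst z" "snd z"] by simp
qed

text \<open>A return from \<open>E\<close> to \<open>E\<close> at time \<open>m\<close> splits the
  sum of length \<open>m + l\<close> into sums of lengths \<open>m\<close> and \<open>l\<close>,
  both comparable with those of \<open>z0\<close>. Since some return time is near any given
  \<open>n\<close>, the sequence \<open>S n z0\<close> is quasi-additive.\<close>

lemma S_bounded_of_stable_section:
  assumes irr: "\<omega> \<notin> \<rat>"
    and E: "E \<in> sets borel" "emeasure circle_borel E > 0"
    and stable: "\<And>\<theta>. \<theta> \<in> E \<Longrightarrow> \<exists>\<xi>. \<forall>n. \<bar>S n (\<theta>, \<xi>) - S n z0\<bar> \<le> 1"
  shows "\<exists>r c. \<forall>n z. \<bar>S n z - real n * r\<bar> \<le> c"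
proof -
  have near: "\<bar>S n (\<theta>, \<xi>) - S n z0\<bar> \<le> 2" if \<theta>: "\<theta> \<in> E" for \<theta> \<xi> n
  proof -
    obtain \<eta> where "\<bar>S n (\<theta>, \<eta>) - S n z0\<bar> \<le> 1" using stable[OF \<theta>] by blast
    with S_fiber_bound[of n \<theta> \<xi> \<eta>] show ?thesis by linarith
  qed
  obtain K where K: "\<And>n. \<exists>m \<theta>. n \<le> m \<and> m \<le> n + K \<and> \<theta> \<in> E \<and> \<theta> + circle_of (real m * \<omega>) \<in> E"
    using return_times_syndetic[OF E, of \<omega>] by blast
  have "compact (UNIV :: (circle \<times> circle) set)"
    using compact_Times[OF compact_UNIV_circle compact_UNIV_circle] by simp
  then have "bounded (range w)"
    using compact_continuous_image[OF cont_w] compact_imp_bounded by blast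
  then obtain b where b: "\<And>z. \<bar>w z\<bar> \<le> b"
    unfolding bounded_iff by auto
  have b0: "b \<ge> 0" using b[of undefined] by linarith
  have Sb: "\<bar>S k z\<bar> \<le> real k * b" for k z
    using sum_norm_bound[of "{..<k}" "\<lambda>j. w ((f ^^ j) z)" b] b by (simp add: birkhoff_sum_def)
  define a where "a n = S n z0" for n
  have step: "\<bar>a (n + k) - a n\<bar> \<le> real K * b" if "k \<le> K" for n k
  proof -
    have "\<bar>a (n + k) - a n\<bar> \<le> real k * b" using Sb by (simp add: a_def birkhoff_sum_add)
    also have "\<dots> \<le> real K * b" using that b0 by (intro mult_right_mono) auto
    finally show ?thesis .
  qed
  \<comment> \<open>Three comparisons with \<open>z0\<close> cost 2 each, and replacing the return
    time \<open>m\<close> by \<open>n\<close> costs \<open>K * b\<close> twice.\<close>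
  have "\<bar>a (n + l) - a n - a l\<bar> \<le> 6 + 2 * (real K * b)" for n l
  proof -
    obtain m \<theta> where m: "n \<le> m" "m \<le> n + K" "\<theta> \<in> E" "\<theta> + circle_of (real m * \<omega>) \<in> E"
      using K by blast
    have fm: "(f ^^ m) (\<theta>, 0) = (\<theta> + circle_of (real m * \<omega>), circle_of (S m (\<theta>, 0)))"
      by (simp add: funpow_f)
    have "\<bar>S (m + l) (\<theta>, 0) - a (m + l)\<bar> \<le> 2" "\<bar>S m (\<theta>, 0) - a m\<bar> \<le> 2"
      "\<bar>S l ((f ^^ m) (\<theta>, 0)) - a l\<bar> \<le> 2"
      unfolding fm a_def using near m(3,4) by auto
    moreover have "\<bar>a (n + l + (m - n)) - a (n + l)\<bar> \<le> real K * b" "\<bar>a (n + (m - n)) - a n\<bar> \<le> real K * b"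
      using m by (intro step; simp)+
    moreover have "n + l + (m - n) = m + l" "n + (m - n) = m" using m by auto
    ultimately show ?thesis
      using birkhoff_sum_add[of f w m l "(\<theta>, 0)"] by (simp add: abs_le_iff)
  qed
  then obtain r where "\<And>n. \<bar>S n z0 - real n * r\<bar> \<le> 6 + 2 * (real K * b)"
    using quasi_additive_linear[of a] unfolding a_def by blast
  from S_bounded_of_one_orbit[OF irr this] show ?thesis by blast
qed

text \<open>The constant of \<open>close_orbits\<close> serves as sensitivity constant. Asking that
  points of \<open>Y\<close> near \<open>z\<close> project onto a set of positive measure covers
  both the whole torus and essential closures.\<close>

theorem sensitive_of_unbounded:
  assumes irr: "\<omega> \<notin> \<rat>"
    and unbounded: "\<And>r c. \<not> (\<forall>n z. \<bar>S n z - real n * r\<bar> \<le> c)"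
    and inv: "f \<in> Y \<rightarrow> Y"
    and fat: "\<And>z d. z \<in> Y \<Longrightarrow> d > 0 \<Longrightarrow>
      \<exists>E\<in>sets borel. emeasure circle_borel E > 0 \<and> (\<forall>\<theta>\<in>E. \<exists>\<xi>. (\<theta>, \<xi>) \<in> Y \<and> dist z (\<theta>, \<xi>) < d)"
  shows "sensitive_dependence_on Y f"
proof -
  obtain e where e: "e > 0"
    "\<And>z z' n. (\<And>n. dist ((f ^^ n) z) ((f ^^ n) z') \<le> e) \<Longrightarrow> \<bar>S n z - S n z'\<bar> \<le> 1"
    using close_orbits by blast
  have "\<exists>n. \<exists>y\<in>Y. dist x y < d \<and> dist ((f ^^ n) x) ((f ^^ n) y) > e" if x: "x \<in> Y" "d > 0" for x d
  proof (rule ccontr)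
    assume "\<not> ?thesis"
    then have stable: "dist ((f ^^ n) y) ((f ^^ n) x) \<le> e" if "y \<in> Y" "dist x y < d" for n y
      using that by (metis dist_commute not_le)
    obtain E where E: "E \<in> sets borel" "emeasure circle_borel E > 0"
      "\<And>\<theta>. \<theta> \<in> E \<Longrightarrow> \<exists>\<xi>. (\<theta>, \<xi>) \<in> Y \<and> dist x (\<theta>, \<xi>) < d"
      using fat[OF x] by blast
    have "\<exists>\<xi>. \<forall>n. \<bar>S n (\<theta>, \<xi>) - S n x\<bar> \<le> 1" if "\<theta> \<in> E" for \<theta>
      using E(3)[OF that] e(2) stable by blast
    from S_bounded_of_stable_section[OF irr E(1,2) this] unbounded show False by blast
  qed
  with e(1) inv show ?thesis
    unfolding sensitive_dependence_on_def by blast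
qed

end

section \<open>Lifts and rotation numbers\<close>

context forced_circle_map
begin

lemma connected_UNIV_circle_real: "connected (UNIV :: (circle \<times> real) set)"
proof -
  have "range circle_of = UNIV" using circle_of_surj by (auto simp: image_iff) metis
  then have "connected (UNIV :: circle set)"
    using connected_continuous_image[OF continuous_on_circle_of connected_UNIV] by simp
  then show ?thesis
    using connected_Times[OF _ connected_UNIV] by (simp flip: UNIV_Times_UNIV)
qed

lemma continuous_on_fiber_lift:
  "continuous_on UNIV (\<lambda>p. snd p + w (fst p, circle_of (snd p)))"
proof (intro continuous_intros continuous_on_compose2[OF cont_w])
  show "continuous_on UNIV (\<lambda>p :: circle \<times> real. circle_of (snd p))"
    by (rule continuous_on_compose2[OF continuous_on_circle_of[of UNIV]]) (auto intro: continuous_intros)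
qed auto

text \<open>The second coordinate of a lift differs from
  \<open>x + w (\<theta>, circle_of x)\<close> by a continuous integer-valued function on a
  connected space.\<close>

lemma is_lift_form:
  assumes "is_lift f F"
  obtains k :: int where
    "\<And>\<theta> x. F (\<theta>, x) = (\<theta> + circle_of \<omega>, x + w (\<theta>, circle_of x) + of_int k)"
proof -
  have cont: "continuous_on UNIV F"
    using assms by (simp add: is_lift_def)
  have proj: "map_prod id circle_of (F p) = f (map_prod id circle_of p)" for p
    using assms unfolding is_lift_def by (metis comp_apply)
  have fst_F: "fst (F (\<theta>, x)) = \<theta> + circle_of \<omega>"
    and snd_F: "circle_of (snd (F (\<theta>, x))) = circle_of (x + w (\<theta>, circle_of x))" for \<theta> x
    using proj[of "(\<theta>, x)"] by (cases "F (\<theta>, x)"; simp add: f_def circle_of_add)+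
  define D where "D p = snd (F p) - (snd p + w (fst p, circle_of (snd p)))" for p
  have D: "D p \<in> \<int>" for p
    using snd_F[of "fst p" "snd p"] by (simp add: D_def circle_of_eq_iff)
  have "D constant_on UNIV"
  proof (rule continuous_discrete_range_constant[OF connected_UNIV_circle_real])
    show "continuous_on UNIV D"
      unfolding D_def by (intro continuous_on_diff continuous_on_fiber_lift continuous_on_snd cont)
    show "\<exists>e>0. \<forall>y. y \<in> UNIV \<and> D y \<noteq> D x \<longrightarrow> e \<le> norm (D y - D x)" for x
      using Ints_nonzero_abs_ge1[OF Ints_diff[OF D D]] by (intro exI[of _ 1]) auto
  qed
  then obtain c where c: "\<And>p. D p = c" by (auto simp: constant_on_def)
  with D obtain k where "c = of_int k" by (metis Ints_cases)
  with c fst_F show thesis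
    by (intro that[of k]) (auto simp: D_def prod_eq_iff algebra_simps)
qed

lemma funpow_lift:
  assumes "\<And>\<theta> x. F (\<theta>, x) = (\<theta> + circle_of \<omega>, x + w (\<theta>, circle_of x) + of_int k)"
  shows "(F ^^ n) (\<theta>, x) =
    (\<theta> + circle_of (real n * \<omega>), x + S n (\<theta>, circle_of x) + real n * of_int k)"
proof (induction n)
  case (Suc n)
  have "circle_of (x + S n (\<theta>, circle_of x) + real n * of_int k) = circle_of x + circle_of (S n (\<theta>, circle_of x))"
    unfolding circle_of_add[symmetric] circle_of_eq_iff by simp
  then show ?case
    by (simp add: Suc assms birkhoff_sum_Suc funpow_f circle_of_add algebra_simps)
qed (simp add: circle_of_0)

lemma is_lift_exists: "\<exists>F. is_lift f F"
proof -
  let ?F = "\<lambda>p. (fst p + circle_of \<omega>, snd p + w (fst p, circle_of (snd p)))"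
  have "continuous_on UNIV ?F"
    by (intro continuous_on_Pair continuous_on_fiber_lift continuous_intros)
  then have "is_lift f ?F"
    by (auto simp: is_lift_def f_def circle_of_add)
  then show ?thesis by blast
qed

text \<open>Bounded deviation forces convergence at rate \<open>c / n\<close>, so the limit in
  \<open>lift_rotation_number\<close> exists and is unique. The lift contributes an integer, which
  vanishes in the circle.\<close>

lemma fiberwise_rotation_number_of_bounded:
  assumes bound: "\<And>n z. \<bar>S n z - real n * r\<bar> \<le> c"
  shows "fiberwise_rotation_number f = circle_of r"
proof -
  define F where "F = (SOME F. is_lift f F)"
  have "is_lift f F" unfolding F_def by (rule someI_ex[OF is_lift_exists])
  then obtain k :: int where k: "\<And>\<theta> x. F (\<theta>, x) = (\<theta> + circle_of \<omega>, x + w (\<theta>, circle_of x) + of_int k)"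
    by (rule is_lift_form) blast
  have lim: "(\<lambda>n. 1 / real n * (snd ((F ^^ n) (\<theta>, x)) - x)) \<longlonglongrightarrow> r + of_int k" for \<theta> x
  proof (rule LIM_zero_cancel, rule Lim_null_comparison)
    have "norm (1 / real n * (snd ((F ^^ n) (\<theta>, x)) - x) - (r + of_int k)) \<le> c / real n" if "n > 0" for n
    proof -
      have "1 / real n * (snd ((F ^^ n) (\<theta>, x)) - x) - (r + of_int k) = (S n (\<theta>, circle_of x) - real n * r) / real n"
        using that by (simp add: funpow_lift[OF k] field_simps)
      then show ?thesis using bound that by (simp add: divide_right_mono)
    qed
    then show "\<forall>\<^sub>F n in sequentially. norm (1 / real n * (snd ((F ^^ n) (\<theta>, x)) - x) - (r + of_int k)) \<le> c / real n"
      by (intro eventually_sequentiallyI[of 1]) auto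
    show "(\<lambda>n. c / real n) \<longlonglongrightarrow> 0" by (rule lim_const_over_n)
  qed
  have "lift_rotation_number F = r + of_int k"
    unfolding lift_rotation_number_def
  proof (rule the_equality)
    show "\<forall>\<theta> \<xi>. (\<lambda>n. 1 / real n * (snd ((F ^^ n) (\<theta>, \<xi>)) - \<xi>)) \<longlonglongrightarrow> r + of_int k"
      using lim by blast
    fix r' assume "\<forall>\<theta> \<xi>. (\<lambda>n. 1 / real n * (snd ((F ^^ n) (\<theta>, \<xi>)) - \<xi>)) \<longlonglongrightarrow> r'"
    then show "r' = r + of_int k" using lim[of 0 0] LIMSEQ_unique by blast
  qed
  then show ?thesis
    unfolding fiberwise_rotation_number_def F_def[symmetric] by (simp add: circle_of_eq_iff)
qed

lemma rho_bounded_imp_S_bounded: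
  assumes "rho_bounded f"
  shows "\<exists>r c. \<forall>n z. \<bar>S n z - real n * r\<bar> \<le> c"
proof -
  obtain F C where F: "is_lift f F"
    and C: "\<And>\<theta> \<xi> n. \<bar>snd ((F ^^ n) (\<theta>, \<xi>)) - \<xi> - real n * lift_rotation_number F\<bar> \<le> C"
    using assms unfolding rho_bounded_def by blast
  obtain k :: int where k: "\<And>\<theta> x. F (\<theta>, x) = (\<theta> + circle_of \<omega>, x + w (\<theta>, circle_of x) + of_int k)"
    using is_lift_form[OF F] by blast
  \<comment> \<open>The lift in \<open>rho_bounded\<close> adds \<open>k\<close> at every step,
    which is absorbed into the drift.\<close>
  have "\<bar>S n z - real n * (lift_rotation_number F - of_int k)\<bar> \<le> C" for n z
  proof -
    obtain x where x: "circle_of x = snd z" using circle_of_surj by blast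
    show ?thesis
      using C[of n "fst z" x] by (simp add: funpow_lift[OF k] x algebra_simps)
  qed
  then show ?thesis by blast
qed

end

section \<open>The projective cocycle and its invariant graphs\<close>

lemma projective_cocycle_displacement:
  assumes "homotopic_with_canon (\<lambda>_. True) UNIV UNIV (projective_cocycle \<omega> A) id"
  obtains w where "continuous_on UNIV w"
    "\<And>z. projective_cocycle \<omega> A z = (fst z + circle_of \<omega>, snd z + circle_of (w z))"
proof -
  let ?g = "projective_cocycle \<omega> A"
  obtain h where h: "continuous_on ({0..1::real} \<times> UNIV) h" "\<And>z. h (0, z) = ?g z" "\<And>z. h (1, z) = z"
    using assms unfolding homotopic_with_def prod_topology_subtopology_eu continuous_map_subtopology_eu
    by (metis id_apply)
  \<comment> \<open>This is the fibre displacement along the homotopy; it vanishes at time 1, where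
    the homotopy ends in the identity.\<close>
  define u where "u p = snd (h p) - snd (snd p)" for p
  have "continuous_on ({0..1} \<times> UNIV) u"
    unfolding u_def by (intro continuous_intros h(1))
  moreover have "compact (UNIV :: (circle \<times> circle) set)"
    using compact_Times[OF compact_UNIV_circle compact_UNIV_circle] by simp
  ultimately obtain w where w: "continuous_on UNIV w" "\<And>z. circle_of (w z) = u (0, z)"
    using nullhomotopic_circle_map_lifts[of u] h(3) by (auto simp: u_def)
  have "?g z = (fst z + circle_of \<omega>, snd z + circle_of (w z))" for z
    by (simp add: w(2) u_def h(2) projective_cocycle_def prod_eq_iff split: prod.split)
  with w(1) show thesis by (rule that)
qed

section \<open>Iterated matrix products and the Lyapunov exponent\<close>

lemma det_cocycle_product:
  assumes "\<And>\<theta>. det (A \<theta>) = 1"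
  shows "det (cocycle_product \<omega> A n \<theta>) = 1"
  by (induction n) (simp_all add: det_mul assms)

lemma funpow_projective_cocycle:
  assumes "\<And>\<theta>. det (A \<theta>) = 1"
  shows "(projective_cocycle \<omega> A ^^ n) (\<theta>, \<xi>) =
    (\<theta> + circle_of (real n * \<omega>), fiber_map (cocycle_product \<omega> A n \<theta>) \<xi>)"
  by (induction n)
     (simp_all add: circle_of_0 fiber_map_id projective_cocycle_def fiber_map_mult assms
       det_cocycle_product circle_of_add algebra_simps)

text \<open>Used in contrapositive form: a positive exponent produces matrix products of arbitrarily
  large norm.\<close>

lemma lyapunov_exponent_nonpos:
  assumes "N \<ge> 1" and bound: "\<And>n \<theta>. onorm ((*v) (cocycle_product \<omega> A n \<theta>)) \<le> N"
  shows "lyapunov_exponent \<omega> A \<le> 0"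
proof -
  interpret finite_measure circle_lebesgue
    by standard (simp add: circle_lebesgue_eq emeasure_completion prob_circle_borel)
  let ?l = "\<lambda>n \<theta>. ln (onorm ((*v) (cocycle_product \<omega> A n \<theta>)))"
  have prob: "measure circle_lebesgue UNIV = 1"
    by (simp add: measure_def circle_lebesgue_eq prob_circle_borel)
  \<comment> \<open>Norm 0 is covered by the convention \<open>ln 0 = 0\<close> and \<open>N\<close>
    \<ge> 1.\<close>
  have l: "?l n \<theta> \<le> ln N" for n \<theta>
  proof (cases "onorm ((*v) (cocycle_product \<omega> A n \<theta>)) = 0")
    case False
    then have "onorm ((*v) (cocycle_product \<omega> A n \<theta>)) > 0"
      using onorm_pos_le[OF matrix_vector_mul_bounded_linear] by (metis less_eq_real_def)
    with bound[of n \<theta>] show ?thesis by simp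
  qed (use assms(1) in simp)
  \<comment> \<open>A non-integrable integrand has integral 0 by convention, and \<open>ln N\<close>
    is nonnegative.\<close>
  have int: "(LINT \<theta>|circle_lebesgue. ?l n \<theta>) \<le> ln N" for n
  proof (cases "integrable circle_lebesgue (?l n)")
    case True
    then have "(LINT \<theta>|circle_lebesgue. ?l n \<theta>) \<le> (LINT \<theta>|circle_lebesgue. ln N)"
      by (intro integral_mono l) auto
    also have "\<dots> = ln N" using prob by simp
    finally show ?thesis .
  qed (use assms(1) in \<open>simp add: not_integrable_integral_eq\<close>)
  have "lyapunov_exponent \<omega> A \<le> liminf (\<lambda>n. ereal (1 / real n * ln N))"
    unfolding lyapunov_exponent_def
    by (intro Liminf_mono always_eventually allI) (use int in \<open>auto intro!: divide_right_mono\<close>)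
  also have "(\<lambda>n. ereal (1 / real n * ln N)) \<longlonglongrightarrow> ereal 0"
    using lim_const_over_n[of "ln N"] by (intro tendsto_ereal) simp
  then have "liminf (\<lambda>n. ereal (1 / real n * ln N)) = ereal 0"
    by (intro lim_imp_Liminf) auto
  finally show ?thesis by (simp add: zero_ereal_def)
qed

section \<open>Supports of measures and essential closures of graphs\<close>

lemma closed_measure_support: "closed (measure_support M)"
  unfolding closed_def measure_support_def by (subst open_subopen) blast

text \<open>The complement is the union of all open null sets, and by Lindelof countably many of
  them suffice.\<close>

lemma emeasure_Compl_measure_support:
  fixes M :: "'a::second_countable_topology measure"
  assumes sets: "sets M = sets borel"
  shows "emeasure M (- measure_support M) = 0"
proof -
  define \<U> where "\<U> = {U. open U \<and> emeasure M U = 0}"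
  have eq: "- measure_support M = \<Union>\<U>"
    by (auto simp: measure_support_def \<U>_def)
  obtain \<U>' where \<U>': "\<U>' \<subseteq> \<U>" "countable \<U>'" "\<Union>\<U>' = \<Union>\<U>"
    using Lindelof[of \<U>] by (auto simp: \<U>_def)
  have "(\<Union>U\<in>\<U>'. U) \<in> null_sets M"
    by (rule null_sets_UN') (use \<U>' in \<open>auto simp: \<U>_def null_sets_def sets\<close>)
  then show ?thesis using eq \<U>'(3) by (simp add: null_sets_def)
qed

text \<open>Removing the exceptional null set and passing to the main part of the completed set
  retains the measure. It turns almost-everywhere statements into pointwise ones on a Borel
  set.\<close>

lemma circle_lebesgue_borel_core:
  assumes E: "E \<in> sets circle_lebesgue" "emeasure circle_lebesgue E > 0"
    and AE: "AE \<theta> in circle_lebesgue. P \<theta>"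
  obtains B where "B \<in> sets borel" "B \<subseteq> E" "\<And>\<theta>. \<theta> \<in> B \<Longrightarrow> P \<theta>" "emeasure circle_borel B > 0"
proof -
  obtain N where N: "{\<theta> \<in> space circle_lebesgue. \<not> P \<theta>} \<subseteq> N" "N \<in> null_sets circle_lebesgue"
    using AE by (auto elim: AE_E simp: null_sets_def)
  have EN: "E - N \<in> sets (completion circle_borel)"
    using E N unfolding circle_lebesgue_eq by auto
  have "emeasure circle_lebesgue (E - N) = emeasure circle_lebesgue E"
    using N(2) E(1) by (rule emeasure_Diff_null_set)
  then have pos: "emeasure circle_borel (main_part circle_borel (E - N)) > 0"
    using E(2) EN by (simp add: circle_lebesgue_eq emeasure_completion)
  have sub: "main_part circle_borel (E - N) \<subseteq> E - N"
    using main_part_null_part_Un[OF EN] by blast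
  show thesis
    by (rule that[OF _ _ _ pos]) (use main_part_sets[OF EN] sub N(1) in auto)
qed

context
  fixes \<phi> :: "circle \<Rightarrow> circle"
  assumes \<phi>: "\<phi> \<in> borel_measurable circle_lebesgue"
begin

lemma measurable_graph: "(\<lambda>\<theta>. (\<theta>, \<phi> \<theta>)) \<in> borel_measurable circle_lebesgue"
proof -
  have "(\<lambda>\<theta>. \<theta>) \<in> circle_borel \<rightarrow>\<^sub>M borel" by simp
  then have "(\<lambda>\<theta>. \<theta>) \<in> borel_measurable circle_lebesgue"
    unfolding circle_lebesgue_eq by (rule measurable_completion)
  then show ?thesis using \<phi> by simp
qed

lemma graph_set: "U \<in> sets borel \<Longrightarrow> {\<theta>. (\<theta>, \<phi> \<theta>) \<in> U} \<in> sets circle_lebesgue"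
  using measurable_sets[OF measurable_graph] by (simp add: vimage_def)

lemma emeasure_graph_measure:
  "U \<in> sets borel \<Longrightarrow> emeasure (graph_measure \<phi>) U = emeasure circle_lebesgue {\<theta>. (\<theta>, \<phi> \<theta>) \<in> U}"
  unfolding graph_measure_def by (subst emeasure_distr[OF measurable_graph]) (simp_all add: vimage_def)

text \<open>Near \<open>z\<close> the graph measure is positive and gives no mass to the complement
  of the support, so the points \<open>(\<theta>, \<phi> \<theta>)\<close> themselves are
  witnesses.\<close>

lemma essential_closure_fat:
  assumes z: "z \<in> essential_closure \<phi>" and "d > 0"
  shows "\<exists>E\<in>sets borel. emeasure circle_borel E > 0 \<and>
    (\<forall>\<theta>\<in>E. \<exists>\<xi>. (\<theta>, \<xi>) \<in> essential_closure \<phi> \<and> dist z (\<theta>, \<xi>) < d)"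
proof -
  let ?K = "essential_closure \<phi>"
  have sets: "sets (graph_measure \<phi>) = sets borel" by (simp add: graph_measure_def)
  have K: "?K \<in> sets borel"
    unfolding essential_closure_def by (intro borel_closed closed_measure_support)
  have "emeasure (graph_measure \<phi>) (ball z d) > 0"
    using z \<open>d > 0\<close> by (simp add: essential_closure_def measure_support_def)
  also have "emeasure (graph_measure \<phi>) (ball z d) \<le> emeasure (graph_measure \<phi>) (ball z d \<inter> ?K) + emeasure (graph_measure \<phi>) (- ?K)"
    by (rule order_trans[OF emeasure_mono emeasure_subadditive]) (use K in \<open>auto simp: sets\<close>)
  also have "emeasure (graph_measure \<phi>) (- ?K) = 0"
    unfolding essential_closure_def by (rule emeasure_Compl_measure_support) (rule sets)
  finally have pos: "emeasure circle_lebesgue {\<theta>. (\<theta>, \<phi> \<theta>) \<in> ball z d \<inter> ?K} > 0"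
    using K by (simp add: emeasure_graph_measure)
  obtain B where "B \<in> sets borel" "B \<subseteq> {\<theta>. (\<theta>, \<phi> \<theta>) \<in> ball z d \<inter> ?K}" "emeasure circle_borel B > 0"
    by (rule circle_lebesgue_borel_core[OF graph_set pos, of "\<lambda>_. True"]) (use K in auto)
  then show ?thesis by (intro bexI[of _ B]) auto
qed

end

text \<open>The graph meets the preimage of a neighbourhood \<open>U\<close> over a set of positive
  measure. By invariance of the graph, it meets \<open>U\<close> over almost all of the translate of
  that set by \<omega>, which has the same measure.\<close>

lemma essential_closure_invariant:
  assumes \<phi>: "invariant_graph \<omega> A \<phi>" and cont: "continuous_on UNIV (projective_cocycle \<omega> A)"
  shows "projective_cocycle \<omega> A \<in> essential_closure \<phi> \<rightarrow> essential_closure \<phi>"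
proof
  let ?g = "projective_cocycle \<omega> A"
  have meas: "\<phi> \<in> borel_measurable circle_lebesgue"
    and AE: "AE \<theta> in circle_lebesgue. fiber_map (A \<theta>) (\<phi> \<theta>) = \<phi> (\<theta> + circle_of \<omega>)"
    using \<phi> by (auto simp: invariant_graph_def)
  fix z assume z: "z \<in> essential_closure \<phi>"
  show "?g z \<in> essential_closure \<phi>"
    unfolding essential_closure_def measure_support_def
  proof (intro CollectI allI impI, elim conjE)
    fix U :: "(circle \<times> circle) set" assume U: "open U" "?g z \<in> U"
    have V: "open (?g -` U)" using cont U(1) by (simp add: continuous_on_open_vimage)
    have "emeasure (graph_measure \<phi>) (?g -` U) > 0"
      using z U V by (simp add: essential_closure_def measure_support_def)
    then have pos: "emeasure circle_lebesgue {\<theta>. (\<theta>, \<phi> \<theta>) \<in> ?g -` U} > 0"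
      using V by (simp add: emeasure_graph_measure[OF meas])
    obtain B where B: "B \<in> sets borel" "B \<subseteq> {\<theta>. (\<theta>, \<phi> \<theta>) \<in> ?g -` U}" "emeasure circle_borel B > 0"
      "\<And>\<theta>. \<theta> \<in> B \<Longrightarrow> fiber_map (A \<theta>) (\<phi> \<theta>) = \<phi> (\<theta> + circle_of \<omega>)"
      by (rule circle_lebesgue_borel_core[OF graph_set[OF meas] pos AE]) (use V in auto)
    let ?B = "{\<theta>. \<theta> + (- circle_of \<omega>) \<in> B}"
    have B': "?B \<in> sets borel" by (rule sets_circle_translate[OF B(1)])
    have "0 < emeasure circle_borel ?B"
      using B(3) by (simp only: emeasure_circle_borel_translate[OF B(1)])
    also have "\<dots> = emeasure circle_lebesgue ?B"
      using B' by (simp add: circle_lebesgue_eq emeasure_completion)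
    also have "\<dots> \<le> emeasure circle_lebesgue {\<theta>. (\<theta>, \<phi> \<theta>) \<in> U}"
    proof (rule emeasure_mono[OF _ graph_set[OF meas]])
      show "?B \<subseteq> {\<theta>. (\<theta>, \<phi> \<theta>) \<in> U}"
      proof
        fix \<theta> assume "\<theta> \<in> ?B"
        then have "\<theta> - circle_of \<omega> \<in> B" by simp
        with B(2) B(4)[of "\<theta> - circle_of \<omega>"] show "\<theta> \<in> {\<theta>. (\<theta>, \<phi> \<theta>) \<in> U}"
          by (auto simp: projective_cocycle_def dest!: subsetD)
      qed
    qed (use U in simp)
    finally show "0 < emeasure (graph_measure \<phi>) U"
      using U(1) by (simp add: emeasure_graph_measure[OF meas])
  qed
qed

section \<open>Application to cocycles with values in SL(2, R)\<close>

theorem mainTheorem5: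
  fixes \<omega> \<rho> :: real and A :: "circle \<Rightarrow> real^2^2"
  assumes irrational: "\<omega> \<notin> \<rat>"
    and continuous: "continuous_on UNIV A"
    and SL2: "\<And>\<theta>. det (A \<theta>) = 1"
    and homotopic_id: "homotopic_with_canon (\<lambda>_. True) UNIV UNIV (projective_cocycle \<omega> A) id"
    and lyapunov: "lyapunov_exponent \<omega> A > 0"
    and rotation: "circle_of \<rho> = fiberwise_rotation_number (projective_cocycle \<omega> A)"
    and independent: "\<And>a b c :: rat.
          of_rat a + of_rat b * \<omega> + of_rat c * \<rho> = 0 \<Longrightarrow> a = 0 \<and> b = 0 \<and> c = 0"
  shows "\<not> rho_bounded (projective_cocycle \<omega> A)
    \<and> sensitive_dependence_on UNIV (projective_cocycle \<omega> A)
    \<and> (\<forall>\<phi>. invariant_graph \<omega> A \<phi> \<longrightarrow>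
          sensitive_dependence_on (essential_closure \<phi>) (projective_cocycle \<omega> A))"
proof -
  let ?g = "projective_cocycle \<omega> A"
  obtain w where w: "continuous_on UNIV w" "\<And>z. ?g z = (fst z + circle_of \<omega>, snd z + circle_of (w z))"
    using projective_cocycle_displacement[OF homotopic_id] by blast
  have fiber: "\<xi> + circle_of (w (\<theta>, \<xi>)) = fiber_map (A \<theta>) \<xi>" for \<theta> \<xi>
    using w(2)[of "(\<theta>, \<xi>)"] by (simp add: projective_cocycle_def)
  interpret forced_circle_map \<omega> w
    by standard (simp_all add: w(1) fiber inj_fiber_map[OF SL2])
  have f_eq: "f = ?g"
    by (rule ext) (simp add: f_def w(2))
  have contraction: "\<exists>\<theta> n P. (\<forall>\<xi>\<in>P. \<forall>\<eta>\<in>P. dist \<xi> \<eta> \<le> e) \<and>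
      (\<forall>\<xi>\<in>-P. \<forall>\<eta>\<in>-P. dist ((f ^^ n) (\<theta>, \<xi>)) ((f ^^ n) (\<theta>, \<eta>)) \<le> e)" if e: "e > 0" for e :: real
  proof -
    \<comment> \<open>Chosen so that the contraction constant \<open>2 / sqrt N\<close> is at most
      \<open>e\<close>.\<close>
    define N where "N = max 1 ((2 / e)\<^sup>2)"
    have "2 / e \<le> sqrt N" unfolding N_def by (rule real_le_rsqrt) simp
    moreover have N: "N \<ge> 1" by (simp add: N_def)
    ultimately have Ne: "2 / sqrt N \<le> e" using e by (simp add: field_simps)
    obtain n \<theta> where "onorm ((*v) (cocycle_product \<omega> A n \<theta>)) > N"
      using lyapunov_exponent_nonpos[OF N, of \<omega> A] lyapunov by (meson not_le)
    from fiber_map_contraction[OF det_cocycle_product[OF SL2] this N]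
    obtain P where "\<forall>\<xi>\<in>P. \<forall>\<eta>\<in>P. dist \<xi> \<eta> \<le> e"
      "\<forall>\<xi>\<in>-P. \<forall>\<eta>\<in>-P. dist (fiber_map (cocycle_product \<omega> A n \<theta>) \<xi>) (fiber_map (cocycle_product \<omega> A n \<theta>) \<eta>) \<le> e"
      using Ne by (meson order_trans)
    then show ?thesis
      by (intro exI[of _ \<theta>] exI[of _ n] exI[of _ P])
        (auto simp: f_eq funpow_projective_cocycle[OF SL2] dist_Pair_Pair)
  qed
  have unbounded: "\<not> (\<forall>n z. \<bar>S n z - real n * r\<bar> \<le> c)" for r c
  proof
    assume bound: "\<forall>n z. \<bar>S n z - real n * r\<bar> \<le> c"
    have "fiberwise_rotation_number f = circle_of r"
      by (rule fiberwise_rotation_number_of_bounded) (use bound in blast)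
    then have "circle_of r = circle_of \<rho>"
      using rotation by (simp add: f_eq)
    then obtain m :: int where m: "r = \<rho> + of_int m"
      unfolding circle_of_eq_iff by (metis Ints_cases add.commute diff_add_cancel)
    \<comment> \<open>As \<open>r\<close> and \<rho> differ by the integer \<open>m\<close>, a
      relation for \<open>r\<close> becomes one for \<rho> with constant term shifted by
      \<open>k * m\<close>.\<close>
    have "i = 0 \<and> j = 0 \<and> k = 0" if "of_int i + of_int j * \<omega> + of_int k * r = 0" for i j k :: int
    proof -
      have "of_rat (of_int (i + k * m)) + of_rat (of_int j) * \<omega> + of_rat (of_int k) * \<rho> = 0"
        using that by (simp add: m of_rat_add of_rat_mult algebra_simps)
      from independent[OF this] show ?thesis by auto
    qed
    from not_bounded_of_contraction[OF this contraction] bound show False by blast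
  qed
  have "\<not> rho_bounded f"
    using rho_bounded_imp_S_bounded unbounded by blast
  moreover have "sensitive_dependence_on UNIV f"
  proof (rule sensitive_of_unbounded[OF irrational unbounded])
    \<comment> \<open>Keeping the second coordinate of \<open>z\<close> puts a whole base ball of
      parameters within distance \<open>d\<close>.\<close>
    fix z :: "circle \<times> circle" and d :: real assume "d > 0"
    then show "\<exists>E\<in>sets borel. emeasure circle_borel E > 0 \<and>
        (\<forall>\<theta>\<in>E. \<exists>\<xi>. (\<theta>, \<xi>) \<in> UNIV \<and> dist z (\<theta>, \<xi>) < d)"
      by (intro bexI[of _ "ball (fst z) d"] conjI emeasure_circle_borel_ball ballI exI[of _ "snd z"])
        (auto simp: dist_prod_def)
  qed simp
  moreover have "sensitive_dependence_on (essential_closure \<phi>) f" if "invariant_graph \<omega> A \<phi>" for \<phi>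
  proof (rule sensitive_of_unbounded[OF irrational unbounded])
    show "f \<in> essential_closure \<phi> \<rightarrow> essential_closure \<phi>"
      using essential_closure_invariant[OF that] continuous_on_f by (simp add: f_eq)
  qed (use that essential_closure_fat in \<open>auto simp: invariant_graph_def\<close>)
  ultimately show ?thesis by (simp add: f_eq)
qed

end
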